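(* Let $\alpha>-1$, let $n$ be a positive integer, let $\psi$ be an analytic function on $\mathbb{D}$ that is not identically $0$, let $\varphi$ be a nonconstant analytic self-map of $\mathbb{D}$, and suppose that $D_{\psi,\varphi,n}$ is bounded on $A_\alpha^2$. Call a pair $(\tilde\psi,\tilde\varphi)$ admissible if there are $a,b\in\mathbb{C}\setminus\{0\}$ and $c\in\mathbb{D}$ such that $$\tilde\varphi(z)=c+\frac{bz}{1-cz},\qquad \tilde\psi(z)=\frac{az^n}{n!\,(1-cz)^{n+\alpha+2}},$$ $\tilde\varphi$ maps $\mathbb{D}$ into itself, and $D_{\tilde\psi,\tilde\varphi,n}$ is bounded on $A_\alpha^2$. (1) Let $p\in\mathbb{D}\setminus\{0\}$, let $\eta\in\mathbb{C}$ with $|\eta|=1$, and let $$\psi_p(z)=\frac{\eta(1-|p|^2)^{\frac{\alpha+2}{2}}}{(1-\overline{p}z)^{\alpha+2}},\qquad \varphi_p(z)=\frac{\overline{p}}{p}\,\frac{p-z}{1-\overline{p}z}.$$ Then $D_{\psi,\varphi,n}$ is complex symmetric with conjugation $C_{\psi_p,\varphi_p}J$ if and only if $\varphi=\tilde\varphi\circ\varphi_p$ and $\psi=\psi_p\cdot(\tilde\psi\circ\varphi_p)$ for some admissible pair $(\tilde\psi,\tilde\varphi)$. (2) Let $\mu,\lambda\in\mathbb{C}$ with $|\mu|=|\lambda|=1$. Then $D_{\psi,\varphi,n}$ is complex symmetric with conjugation $C_{\mu,\lambda z}J$ if and only if $\psi(z)=\mu\,\tilde\psi(\lambda z)$ and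 $\varphi(z)=\tilde\varphi(\lambda z)$ for some admissible pair $(\tilde\psi,\tilde\varphi)$.
   Context: $\mathbb{D}$ is the open unit disk in $\mathbb{C}$. For $\alpha>-1$, the weighted Bergman space $A_\alpha^2$ is the Hilbert space of analytic functions $f(z)=\sum_{j\ge0}a_jz^j$ on $\mathbb{D}$ with $\|f\|^2=\sum_{j\ge0}|a_j|^2\beta(j)^2<\infty$, where $\beta(j)^2=\frac{j!\,\Gamma(\alpha+2)}{\Gamma(j+\alpha+2)}$, with inner product $\langle\sum a_jz^j,\sum b_jz^j\rangle=\sum a_j\overline{b_j}\beta(j)^2$. Non-integer powers of $1-cz$, $1-\overline{p}z$ use the principal branch. The weighted composition--differentiation operator of order $n$ is $D_{\psi,\varphi,n}f=\psi\cdot(f^{(n)}\circ\varphi)$. The weighted composition operator is $C_{\psi,\varphi}f=\psi\cdot(f\circ\varphi)$; $C_{\mu,\lambda z}$ denotes the one with constant weight $\mu$ and self-map $z\mapsto\lambda z$, i.e. $(C_{\mu,\lambda z}f)(z)=\mu f(\lambda z)$. A conjugation on a complex Hilbert space is an antilinear isometric involution $C$; a bounded operator $T$ is complex symmetric with conjugation $C$ ($C$-symmetric) if $CT^*C=T$. $J$ is the conjugation $(Jf)(z)=\overline{f(\overline{z})}$. It is known that $C_{\psi_p,\varphi_p}J$ and $C_{\mu,\lambda z}J$ are conjugations on $A_\alpha^2$. *)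

theory Defs
  imports "HOL-Complex_Analysis.Complex_Analysis"
begin

abbreviation unit_disk :: "complex set" where
  "unit_disk \<equiv> ball 0 1"

definition taylor_coeff :: "(complex \<Rightarrow> complex) \<Rightarrow> nat \<Rightarrow> complex" where
  "taylor_coeff f j = (deriv ^^ j) f 0 / fact j"

definition bergman_weight :: "real \<Rightarrow> nat \<Rightarrow> real" where
  "bergman_weight \<alpha> j = fact j * Gamma (\<alpha> + 2) / Gamma (real j + \<alpha> + 2)"

text \<open>
  Functions on the disk are represented by total functions that vanish outside it, so that
  two elements of the space agree on the disk iff they are equal. The operators below
  accordingly return functions vanishing outside the disk.
\<close>

definition bergman_space :: "real \<Rightarrow> (complex \<Rightarrow> complex) set" where
  "bergman_space \<alpha> = {f. f holomorphic_on unit_disk \<and> (\<forall>z. z \<notin> unit_disk \<longrightarrow> f z = 0) \<and>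
     summable (\<lambda>j. (cmod (taylor_coeff f j))\<^sup>2 * bergman_weight \<alpha> j)}"

definition bergman_inner ::
    "real \<Rightarrow> (complex \<Rightarrow> complex) \<Rightarrow> (complex \<Rightarrow> complex) \<Rightarrow> complex" where
  "bergman_inner \<alpha> f g =
     (\<Sum>j. taylor_coeff f j * cnj (taylor_coeff g j) * complex_of_real (bergman_weight \<alpha> j))"

definition bergman_norm :: "real \<Rightarrow> (complex \<Rightarrow> complex) \<Rightarrow> real" where
  "bergman_norm \<alpha> f = sqrt (\<Sum>j. (cmod (taylor_coeff f j))\<^sup>2 * bergman_weight \<alpha> j)"

type_synonym fun_operator = "(complex \<Rightarrow> complex) \<Rightarrow> (complex \<Rightarrow> complex)"

definition bounded_operator :: "real \<Rightarrow> fun_operator \<Rightarrow> bool" where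
  "bounded_operator \<alpha> T \<longleftrightarrow>
     (\<forall>f\<in>bergman_space \<alpha>. T f \<in> bergman_space \<alpha>) \<and>
     (\<forall>f\<in>bergman_space \<alpha>. \<forall>g\<in>bergman_space \<alpha>. T (\<lambda>z. f z + g z) = (\<lambda>z. T f z + T g z)) \<and>
     (\<forall>k. \<forall>f\<in>bergman_space \<alpha>. T (\<lambda>z. k * f z) = (\<lambda>z. k * T f z)) \<and>
     (\<exists>M. \<forall>f\<in>bergman_space \<alpha>. bergman_norm \<alpha> (T f) \<le> M * bergman_norm \<alpha> f)"

text \<open>For a bounded operator the described vector exists uniquely, by Riesz representation.\<close>

definition hilbert_adjoint :: "real \<Rightarrow> fun_operator \<Rightarrow> fun_operator" where
  "hilbert_adjoint \<alpha> T g =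
     (THE h. h \<in> bergman_space \<alpha> \<and>
        (\<forall>f\<in>bergman_space \<alpha>. bergman_inner \<alpha> (T f) g = bergman_inner \<alpha> f h))"

definition conjugation :: "real \<Rightarrow> fun_operator \<Rightarrow> bool" where
  "conjugation \<alpha> C \<longleftrightarrow>
     (\<forall>f\<in>bergman_space \<alpha>. C f \<in> bergman_space \<alpha>) \<and>
     (\<forall>f\<in>bergman_space \<alpha>. \<forall>g\<in>bergman_space \<alpha>. C (\<lambda>z. f z + g z) = (\<lambda>z. C f z + C g z)) \<and>
     (\<forall>k. \<forall>f\<in>bergman_space \<alpha>. C (\<lambda>z. k * f z) = (\<lambda>z. cnj k * C f z)) \<and>
     (\<forall>f\<in>bergman_space \<alpha>. bergman_norm \<alpha> (C f) = bergman_norm \<alpha> f) \<and>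
     (\<forall>f\<in>bergman_space \<alpha>. C (C f) = f)"

definition complex_symmetric :: "real \<Rightarrow> fun_operator \<Rightarrow> fun_operator \<Rightarrow> bool" where
  "complex_symmetric \<alpha> C T \<longleftrightarrow>
     conjugation \<alpha> C \<and> bounded_operator \<alpha> T \<and>
     (\<forall>f\<in>bergman_space \<alpha>. C (hilbert_adjoint \<alpha> T (C f)) = T f)"

definition comp_diff_op ::
    "(complex \<Rightarrow> complex) \<Rightarrow> (complex \<Rightarrow> complex) \<Rightarrow> nat \<Rightarrow> fun_operator" where
  "comp_diff_op \<psi> \<phi> n f = (\<lambda>z. if z \<in> unit_disk then \<psi> z * (deriv ^^ n) f (\<phi> z) else 0)"

definition weighted_comp_op ::
    "(complex \<Rightarrow> complex) \<Rightarrow> (complex \<Rightarrow> complex) \<Rightarrow> fun_operator" where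
  "weighted_comp_op \<psi> \<phi> f = (\<lambda>z. if z \<in> unit_disk then \<psi> z * f (\<phi> z) else 0)"

definition J_conj :: fun_operator where
  "J_conj f = (\<lambda>z. cnj (f (cnj z)))"

definition psi_p :: "real \<Rightarrow> complex \<Rightarrow> complex \<Rightarrow> complex \<Rightarrow> complex" where
  "psi_p \<alpha> \<eta> p z =
     \<eta> * complex_of_real ((1 - (cmod p)\<^sup>2) powr ((\<alpha> + 2) / 2))
       / (1 - cnj p * z) powr complex_of_real (\<alpha> + 2)"

definition phi_p :: "complex \<Rightarrow> complex \<Rightarrow> complex" where
  "phi_p p z = cnj p / p * ((p - z) / (1 - cnj p * z))"

definition admissible ::
    "real \<Rightarrow> nat \<Rightarrow> (complex \<Rightarrow> complex) \<Rightarrow> (complex \<Rightarrow> complex) \<Rightarrow> bool" where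
  "admissible \<alpha> n \<psi> \<phi> \<longleftrightarrow>
     (\<exists>a b c. a \<noteq> 0 \<and> b \<noteq> 0 \<and> c \<in> unit_disk \<and>
        (\<forall>z\<in>unit_disk. \<phi> z = c + b * z / (1 - c * z)) \<and>
        (\<forall>z\<in>unit_disk. \<psi> z =
           a * z ^ n / (fact n * (1 - c * z) powr complex_of_real (real n + \<alpha> + 2)))) \<and>
     \<phi> ` unit_disk \<subseteq> unit_disk \<and>
     bounded_operator \<alpha> (comp_diff_op \<psi> \<phi> n)"

end

theory Submission
  imports Defs
begin

text \<open>
  Both conjugations have the form \<open>C f (z) = \<omega>(z) \<cdot> cnj (f (cnj (\<theta>(z))))\<close>, and \<open>C\<close> maps the
  reproducing kernel \<open>K\<^sub>w\<close> to \<open>\<omega>(w) \<cdot> K\<close> at \<open>cnj (\<theta>(w))\<close>. Since kernels are total, the operator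
  \<open>T\<close> is \<open>C\<close>-symmetric iff the inner product of \<open>T K\<^sub>v\<close> and \<open>C K\<^sub>u\<close> is symmetric in \<open>u\<close>, \<open>v\<close>.
  After undoing the change of variables by \<open>\<theta>\<close> and \<open>\<omega>\<close>, this is the symmetry of
  \<open>\<psi>(x) \<cdot> y\<^sup>n \<cdot> (1 - y \<phi>(x)) powr (-s)\<close> in \<open>x\<close>, \<open>y\<close>, where \<open>s = n + \<alpha> + 2\<close>.
  Letting \<open>y\<close> tend to \<open>0\<close> determines \<open>\<psi>\<close>, and differentiating in \<open>y\<close> at \<open>0\<close> then determines \<open>\<phi>\<close>.

  That \<open>C\<close> is isometric is read off the matrix of \<open>C\<close> in the monomial basis: symmetry of
  \<open>C K\<^sub>w (z)\<close> in \<open>z\<close> and \<open>w\<close> makes it symmetric with respect to the weights, and together with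
  \<open>C\<^sup>2 = 1\<close> this makes its columns orthogonal of the right norm.
\<close>

section \<open>Taylor coefficients on the unit disk\<close>

lemma taylor_sums:
  assumes "f holomorphic_on unit_disk" "z \<in> unit_disk"
  shows "(\<lambda>j. taylor_coeff f j * z ^ j) sums f z"
  using holomorphic_power_series[OF assms] by (simp add: taylor_coeff_def)

text \<open>Convergence at every real radius \<open>r < 1\<close> already forces a radius of
  convergence of at least 1. Later coefficient comparisons, including those in the kernel variable
  \<open>w\<close>, rest on this uniqueness of the expansion.\<close>

lemma power_series_holomorphic_and_coeff:
  fixes a :: "nat \<Rightarrow> complex"
  assumes "\<And>z. z \<in> unit_disk \<Longrightarrow> (\<lambda>j. a j * z ^ j) sums f z"
  shows "f holomorphic_on unit_disk" "taylor_coeff f = a"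
proof -
  have "conv_radius a \<ge> 1"
  proof (rule conv_radius_geI_ex)
    fix r :: real assume "0 < r" "ereal r < 1"
    then have "complex_of_real r \<in> unit_disk" by simp
    from assms[OF this] show "\<exists>z. norm z = r \<and> summable (\<lambda>n. a n * z ^ n)"
      using \<open>0 < r\<close> by (intro exI[of _ "of_real r"]) (auto simp: sums_iff)
  qed
  then have R: "fps_conv_radius (Abs_fps a) \<ge> 1"
    by (simp add: fps_conv_radius_def)
  have eq: "eval_fps (Abs_fps a) z = f z" if "z \<in> unit_disk" for z
    using assms[OF that] by (simp add: eval_fps_def sums_iff)
  have sub: "unit_disk \<subseteq> eball (0::complex) (fps_conv_radius (Abs_fps a))"
    using R by (auto simp: in_eball_iff intro!: less_le_trans[OF _ R])
  have "eval_fps (Abs_fps a) holomorphic_on unit_disk"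
    by (rule holomorphic_on_eval_fps[OF sub])
  then show "f holomorphic_on unit_disk"
    by (rule holomorphic_transform) (use eq in auto)
  have "f has_fps_expansion Abs_fps a"
    unfolding has_fps_expansion_def
  proof
    show "0 < fps_conv_radius (Abs_fps a)"
      by (rule less_le_trans[OF _ R]) simp
    show "\<forall>\<^sub>F z in nhds 0. eval_fps (Abs_fps a) z = f z"
      by (rule eventually_nhds_in_open[of unit_disk, THEN eventually_mono]) (use eq in auto)
  qed
  from fps_nth_fps_expansion[OF this] show "taylor_coeff f = a"
    by (simp add: taylor_coeff_def fun_eq_iff)
qed

lemma taylor_coeff_cong:
  assumes "\<And>z. z \<in> unit_disk \<Longrightarrow> f z = g z"
  shows "taylor_coeff f = taylor_coeff g"
proof
  fix j
  have "(deriv ^^ j) f 0 = (deriv ^^ j) g 0"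
    by (rule higher_deriv_cong_ev)
       (auto intro!: eventually_nhds_in_open[of unit_disk, THEN eventually_mono] assms)
  then show "taylor_coeff f j = taylor_coeff g j"
    by (simp add: taylor_coeff_def)
qed

lemma taylor_coeff_add:
  assumes "f holomorphic_on unit_disk" "g holomorphic_on unit_disk"
  shows "taylor_coeff (\<lambda>z. f z + g z) j = taylor_coeff f j + taylor_coeff g j"
  by (simp add: taylor_coeff_def higher_deriv_add[OF assms] add_divide_distrib)

lemma taylor_coeff_cmult:
  assumes "f holomorphic_on unit_disk"
  shows "taylor_coeff (\<lambda>z. k * f z) j = k * taylor_coeff f j"
  by (simp add: taylor_coeff_def higher_deriv_cmult[OF assms])

lemma taylor_coeff_sum:
  assumes "\<And>i. i \<in> I \<Longrightarrow> f i holomorphic_on unit_disk"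
  shows "taylor_coeff (\<lambda>z. \<Sum>i\<in>I. f i z) j = (\<Sum>i\<in>I. taylor_coeff (f i) j)"
proof -
  have 0: "taylor_coeff (\<lambda>z. 0) j = 0"
    using taylor_coeff_cmult[of "\<lambda>z. 0" 0 j] by simp
  show ?thesis
    using assms by (induction I rule: infinite_finite_induct)
      (auto simp: 0 taylor_coeff_add holomorphic_on_sum)
qed

section \<open>Principal powers of \<open>1 - a * z\<close> on the disk\<close>

lemma one_minus_mult_notin_nonpos_Reals:
  fixes a z :: complex
  assumes "a \<in> unit_disk" "z \<in> unit_disk"
  shows "1 - a * z \<notin> \<real>\<^sub>\<le>\<^sub>0" "Re (1 - a * z) > 0" "1 - a * z \<noteq> 0"
proof -
  have "cmod (a * z) < 1"
    using assms by (simp add: norm_mult) (metis mult_strict_mono' norm_ge_zero mult_1_left)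
  then show re: "Re (1 - a * z) > 0"
    using complex_Re_le_cmod[of "a * z"] by simp
  then show "1 - a * z \<notin> \<real>\<^sub>\<le>\<^sub>0" by (auto simp: complex_nonpos_Reals_iff)
  then show "1 - a * z \<noteq> 0" by auto
qed

text \<open>The principal power is not multiplicative in general. Here all four arguments lie
  strictly between -pi/2 and pi/2, so both sums of logarithms have imaginary part in (-pi, pi);
  being equal modulo 2 pi i, they are equal.\<close>

lemma powr_eqI_of_mult_eq:
  fixes s a b c d :: complex
  assumes "Re a > 0" "Re b > 0" "Re c > 0" "Re d > 0" "a * b = c * d"
  shows "a powr s * b powr s = c powr s * d powr s"
proof -
  have nz: "a \<noteq> 0" "b \<noteq> 0" "c \<noteq> 0" "d \<noteq> 0" using assms by auto
  have "exp (Ln a + Ln b) = exp (Ln c + Ln d)"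
    using assms nz by (simp add: exp_add)
  then obtain k :: int where k: "Ln a + Ln b = Ln c + Ln d + of_int (2 * k) * pi * \<i>"
    by (auto simp: exp_eq)
  have im: "\<bar>Im (Ln x)\<bar> < pi / 2" if "Re x > 0" for x
    using that Re_Ln_pos_lt_imp by blast
  have "Im (Ln a + Ln b) = Im (Ln c + Ln d) + 2 * of_int k * pi"
    by (subst k) simp
  then have "\<bar>2 * of_int k * pi\<bar> < 2 * pi"
    using im[OF assms(1)] im[OF assms(2)] im[OF assms(3)] im[OF assms(4)]
    unfolding plus_complex.sel by linarith
  then have "\<bar>real_of_int k\<bar> < 1" by (simp add: abs_mult)
  then have "k = 0" by linarith
  with k have "s * Ln a + s * Ln b = s * Ln c + s * Ln d"
    by (simp flip: distrib_left)
  then show ?thesis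
    using nz by (simp add: powr_def flip: exp_add)
qed

text \<open>Each differentiation contributes a factor \<open>(s + of_nat n) * a\<close>, which
  builds up the Pochhammer symbol. At \<open>z = 0\<close> this yields the kernel coefficients, at
  \<open>\<phi> x\<close> the n-th derivative of a kernel.\<close>

lemma higher_deriv_one_minus_powr:
  fixes a s z :: complex
  assumes a: "a \<in> unit_disk" and z: "z \<in> unit_disk"
  shows "(deriv ^^ n) (\<lambda>z. (1 - a * z) powr (- s)) z
    = pochhammer s n * a ^ n * (1 - a * z) powr (- (s + of_nat n))"
  using z
proof (induction n arbitrary: z)
  case 0
  then show ?case by simp
next
  case (Suc n)
  let ?g = "\<lambda>z. pochhammer s n * a ^ n * (1 - a * z) powr (- (s + of_nat n))"
  have "(?g has_field_derivative
      pochhammer s n * a ^ n * (- (s + of_nat n) * (1 - a * z) powr (- (s + of_nat n) - 1) * (- a))) (at z)"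
    using one_minus_mult_notin_nonpos_Reals(1)[OF a Suc.prems]
    by (auto intro!: derivative_eq_intros)
  moreover have "deriv ((deriv ^^ n) (\<lambda>z. (1 - a * z) powr (- s))) z = deriv ?g z"
    by (rule deriv_cong_ev[OF eventually_mono[OF eventually_nhds_in_open[of unit_disk]]])
      (use Suc in auto)
  moreover have "- (s + of_nat n) - 1 = - (s + of_nat (Suc n))"
    by simp
  ultimately have "deriv ((deriv ^^ n) (\<lambda>z. (1 - a * z) powr (- s))) z = pochhammer s n * a ^ n *
      (- (s + of_nat n) * (1 - a * z) powr (- (s + of_nat (Suc n))) * (- a))"
    by (metis DERIV_imp_deriv)
  also have "\<dots> = (pochhammer s n * (s + of_nat n)) * (a * a ^ n) * (1 - a * z) powr (- (s + of_nat (Suc n)))"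
    unfolding mult_minus_left mult_minus_right minus_minus by (simp only: mult_ac)
  finally show ?case
    by (simp only: pochhammer_Suc power_Suc funpow.simps o_def)
qed

lemma one_minus_powr_holomorphic:
  assumes "a \<in> unit_disk"
  shows "(\<lambda>z. (1 - a * z) powr s) holomorphic_on unit_disk"
  using one_minus_mult_notin_nonpos_Reals(1)[OF assms]
  by (intro holomorphic_intros) auto

section \<open>The weighted Bergman space as a reproducing kernel Hilbert space\<close>

text \<open>The reproducing kernel at the point \<open>w\<close>, cut off outside the disk so as to
  be an element of \<open>bergman_space\<close>.\<close>

definition bergman_kernel :: "real \<Rightarrow> complex \<Rightarrow> complex \<Rightarrow> complex" where
  "bergman_kernel \<alpha> w z =
     (if z \<in> unit_disk then (1 - cnj w * z) powr (- complex_of_real (\<alpha> + 2)) else 0)"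

text \<open>Used for truncated Taylor series; the cutoff again places them in the space.\<close>

definition disk_poly :: "(nat \<Rightarrow> complex) \<Rightarrow> nat \<Rightarrow> complex \<Rightarrow> complex" where
  "disk_poly a N z = (if z \<in> unit_disk then \<Sum>j<N. a j * z ^ j else 0)"

definition bounded_functional :: "real \<Rightarrow> ((complex \<Rightarrow> complex) \<Rightarrow> complex) \<Rightarrow> bool" where
  "bounded_functional \<alpha> L \<longleftrightarrow>
     (\<forall>f\<in>bergman_space \<alpha>. \<forall>g\<in>bergman_space \<alpha>. L (\<lambda>z. f z + g z) = L f + L g) \<and>
     (\<forall>k. \<forall>f\<in>bergman_space \<alpha>. L (\<lambda>z. k * f z) = k * L f) \<and>
     (\<exists>M. \<forall>f\<in>bergman_space \<alpha>. cmod (L f) \<le> M * bergman_norm \<alpha> f)"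

lemma taylor_coeff_disk_poly: "taylor_coeff (disk_poly a N) = (\<lambda>j. if j < N then a j else 0)"
  and disk_poly_holomorphic: "disk_poly a N holomorphic_on unit_disk"
proof -
  have "(\<lambda>j. (if j < N then a j else 0) * z ^ j) sums disk_poly a N z" if "z \<in> unit_disk" for z
    using sums_If_finite_set[of "{..<N}" "\<lambda>j. a j * z ^ j"] that
    by (simp add: disk_poly_def if_distrib[of "\<lambda>x. x * _"] cong: if_cong)
  from power_series_holomorphic_and_coeff[OF this]
  show "taylor_coeff (disk_poly a N) = (\<lambda>j. if j < N then a j else 0)"
    "disk_poly a N holomorphic_on unit_disk" by auto
qed

locale bergman =
  fixes \<alpha> :: real
  assumes alpha: "\<alpha> > -1"
begin

abbreviation "H \<equiv> bergman_space \<alpha>"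
abbreviation "\<beta> \<equiv> bergman_weight \<alpha>"
abbreviation "ip \<equiv> bergman_inner \<alpha>"
abbreviation "nrm \<equiv> bergman_norm \<alpha>"
abbreviation "tc \<equiv> taylor_coeff"
abbreviation "K \<equiv> bergman_kernel \<alpha>"

text \<open>In Pochhammer form \<open>1 / \<beta> j\<close> is visibly the j-th binomial coefficient
  of \<open>(1 - x) powr (- (\<alpha> + 2))\<close>, which links the weights to the kernel.\<close>

lemma weight_eq: "\<beta> j = fact j / pochhammer (\<alpha> + 2) j"
  and weight_pos: "\<beta> j > 0"
proof -
  have pos: "\<alpha> + 2 > 0" "\<alpha> + 2 + j > 0" using alpha by auto
  have "\<alpha> + 2 \<notin> \<int>\<^sub>\<le>\<^sub>0" using pos by (auto elim!: nonpos_Ints_cases)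
  then have "pochhammer (\<alpha> + 2) j = Gamma (\<alpha> + 2 + j) / Gamma (\<alpha> + 2)"
    by (rule pochhammer_Gamma)
  then show "\<beta> j = fact j / pochhammer (\<alpha> + 2) j"
    by (simp add: bergman_weight_def add_ac)
  then show "\<beta> j > 0" using pochhammer_pos[OF pos(1)] by simp
qed

lemma weight_nonneg: "\<beta> j \<ge> 0"
  using weight_pos[of j] by simp

lemma bergmanD:
  assumes "f \<in> H"
  shows "f holomorphic_on unit_disk" "\<And>z. z \<notin> unit_disk \<Longrightarrow> f z = 0"
    "summable (\<lambda>j. (cmod (tc f j))\<^sup>2 * \<beta> j)"
  using assms by (auto simp: bergman_space_def)

lemma bergmanI:
  assumes "f holomorphic_on unit_disk" "\<And>z. z \<notin> unit_disk \<Longrightarrow> f z = 0"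
    "summable (\<lambda>j. (cmod (tc f j))\<^sup>2 * \<beta> j)"
  shows "f \<in> H"
  using assms by (auto simp: bergman_space_def)

lemma bergman_eqI:
  assumes "f \<in> H" "g \<in> H" "\<And>z. z \<in> unit_disk \<Longrightarrow> f z = g z"
  shows "f = g"
proof
  show "f z = g z" for z
    using bergmanD(2)[OF assms(1), of z] bergmanD(2)[OF assms(2), of z] assms(3)[of z]
    by (cases "z \<in> unit_disk") simp_all
qed

lemma norm_nonneg: "nrm f \<ge> 0" if "f \<in> H"
  unfolding bergman_norm_def using weight_nonneg bergmanD(3)[OF that]
  by (auto intro!: suminf_nonneg)

lemma norm_power2: "(nrm f)\<^sup>2 = (\<Sum>j. (cmod (tc f j))\<^sup>2 * \<beta> j)" if "f \<in> H"
  unfolding bergman_norm_def using weight_nonneg bergmanD(3)[OF that]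
  by (auto intro!: suminf_nonneg)

lemma sum_le_norm_power2: "(\<Sum>j<N. (cmod (tc f j))\<^sup>2 * \<beta> j) \<le> (nrm f)\<^sup>2" if "f \<in> H"
  unfolding norm_power2[OF that] using weight_nonneg bergmanD(3)[OF that]
  by (intro sum_le_suminf) auto

lemma bergman_add:
  assumes "f \<in> H" "g \<in> H" shows "(\<lambda>z. f z + g z) \<in> H"
proof (rule bergmanI)
  note f = bergmanD[OF assms(1)] and g = bergmanD[OF assms(2)]
  show "(\<lambda>z. f z + g z) holomorphic_on unit_disk" using f g by (intro holomorphic_intros)
  show "f z + g z = 0" if "z \<notin> unit_disk" for z using f g that by simp
  have s: "summable (\<lambda>j. 2 * ((cmod (tc f j))\<^sup>2 * \<beta> j) + 2 * ((cmod (tc g j))\<^sup>2 * \<beta> j))"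
    using f g by (intro summable_add summable_mult)
  have "(cmod (tc f j + tc g j))\<^sup>2 * \<beta> j
    \<le> 2 * ((cmod (tc f j))\<^sup>2 * \<beta> j) + 2 * ((cmod (tc g j))\<^sup>2 * \<beta> j)" for j
  proof -
    have "(cmod (tc f j + tc g j))\<^sup>2 \<le> (cmod (tc f j) + cmod (tc g j))\<^sup>2"
      by (intro power_mono norm_triangle_ineq) auto
    also have "\<dots> \<le> 2 * (cmod (tc f j))\<^sup>2 + 2 * (cmod (tc g j))\<^sup>2"
      using sum_squares_bound[of "cmod (tc f j)" "cmod (tc g j)"] by (simp add: power2_sum)
    finally have "(cmod (tc f j + tc g j))\<^sup>2 * \<beta> j
        \<le> (2 * (cmod (tc f j))\<^sup>2 + 2 * (cmod (tc g j))\<^sup>2) * \<beta> j"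
      using weight_nonneg by (rule mult_right_mono)
    then show ?thesis by (simp add: algebra_simps)
  qed
  then show "summable (\<lambda>j. (cmod (tc (\<lambda>z. f z + g z) j))\<^sup>2 * \<beta> j)"
    by (intro summable_comparison_test'[OF s])
       (simp_all add: taylor_coeff_add[OF f(1) g(1)] weight_nonneg abs_mult)
qed

lemma bergman_cmult:
  assumes "f \<in> H" shows "(\<lambda>z. k * f z) \<in> H"
    and "nrm (\<lambda>z. k * f z) = cmod k * nrm f"
proof -
  note f = bergmanD[OF assms]
  have eq: "(cmod (tc (\<lambda>z. k * f z) j))\<^sup>2 * \<beta> j = (cmod k)\<^sup>2 * ((cmod (tc f j))\<^sup>2 * \<beta> j)" for j
    by (simp add: taylor_coeff_cmult[OF f(1)] norm_mult power_mult_distrib)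
  show "(\<lambda>z. k * f z) \<in> H"
  proof (rule bergmanI)
    show "(\<lambda>z. k * f z) holomorphic_on unit_disk" using f by (intro holomorphic_intros)
    show "k * f z = 0" if "z \<notin> unit_disk" for z using f that by simp
    show "summable (\<lambda>j. (cmod (tc (\<lambda>z. k * f z) j))\<^sup>2 * \<beta> j)"
      unfolding eq using f by (intro summable_mult)
  qed
  show "nrm (\<lambda>z. k * f z) = cmod k * nrm f"
    unfolding bergman_norm_def eq using f by (simp add: suminf_mult real_sqrt_mult)
qed

lemma disk_poly_in: "disk_poly a N \<in> H"
proof (rule bergmanI)
  show "summable (\<lambda>j. (cmod (tc (disk_poly a N) j))\<^sup>2 * \<beta> j)"
    by (rule summable_finite[of "{..<N}"]) (auto simp: taylor_coeff_disk_poly)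
qed (auto simp: disk_poly_holomorphic disk_poly_def)

lemma norm_disk_poly: "(nrm (disk_poly a N))\<^sup>2 = (\<Sum>j<N. (cmod (a j))\<^sup>2 * \<beta> j)"
  unfolding norm_power2[OF disk_poly_in]
  by (subst suminf_finite[of "{..<N}"]) (auto simp: taylor_coeff_disk_poly)

section \<open>The inner product and the Cauchy-Schwarz inequality\<close>

lemma inner_abs_summable:
  assumes "f \<in> H" "g \<in> H"
  shows "summable (\<lambda>j. cmod (tc f j * cnj (tc g j) * complex_of_real (\<beta> j)))"
proof -
  note f = bergmanD[OF assms(1)] and g = bergmanD[OF assms(2)]
  have s: "summable (\<lambda>j. (cmod (tc f j))\<^sup>2 * \<beta> j + (cmod (tc g j))\<^sup>2 * \<beta> j)"
    using f g by (intro summable_add)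
  have "cmod (tc f j) * cmod (tc g j) * \<beta> j \<le> (cmod (tc f j))\<^sup>2 * \<beta> j + (cmod (tc g j))\<^sup>2 * \<beta> j" for j
  proof -
    have "0 \<le> (cmod (tc f j))\<^sup>2 + (cmod (tc g j))\<^sup>2" by simp
    then have "cmod (tc f j) * cmod (tc g j) \<le> (cmod (tc f j))\<^sup>2 + (cmod (tc g j))\<^sup>2"
      using sum_squares_bound[of "cmod (tc f j)" "cmod (tc g j)"] by linarith
    then have "cmod (tc f j) * cmod (tc g j) * \<beta> j \<le> ((cmod (tc f j))\<^sup>2 + (cmod (tc g j))\<^sup>2) * \<beta> j"
      using weight_nonneg by (rule mult_right_mono)
    then show ?thesis by (simp add: algebra_simps)
  qed
  then show ?thesis
    by (intro summable_comparison_test'[OF s]) (simp add: norm_mult weight_nonneg)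
qed

lemma inner_sums:
  assumes "f \<in> H" "g \<in> H"
  shows "(\<lambda>j. tc f j * cnj (tc g j) * complex_of_real (\<beta> j)) sums ip f g"
  unfolding bergman_inner_def
  using summable_norm_cancel[OF inner_abs_summable[OF assms]] by (rule summable_sums)

text \<open>The weight is split as \<open>sqrt (\<beta> j) * sqrt (\<beta> j)\<close> between the
  two factors, so that the finite inequality applies to partial sums; the bound survives the
  limit.\<close>

lemma Cauchy_Schwarz:
  assumes "f \<in> H" "g \<in> H"
  shows "cmod (ip f g) \<le> nrm f * nrm g"
proof -
  have "cmod (\<Sum>j<N. tc f j * cnj (tc g j) * complex_of_real (\<beta> j)) \<le> nrm f * nrm g" for N
  proof -
    let ?a = "\<lambda>h j. cmod (tc h j) * sqrt (\<beta> j)"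
    have a2: "(\<Sum>j<N. (?a h j)\<^sup>2) \<le> (nrm h)\<^sup>2" if "h \<in> H" for h
      using sum_le_norm_power2[OF that, of N] weight_nonneg by (simp add: power_mult_distrib)
    have "cmod (\<Sum>j<N. tc f j * cnj (tc g j) * complex_of_real (\<beta> j)) \<le> (\<Sum>j<N. ?a f j * ?a g j)"
    proof (rule sum_norm_le)
      fix j
      have "cmod (tc f j * cnj (tc g j) * complex_of_real (\<beta> j))
          = cmod (tc f j) * cmod (tc g j) * (sqrt (\<beta> j) * sqrt (\<beta> j))"
        using weight_nonneg[of j] by (simp add: norm_mult)
      then show "cmod (tc f j * cnj (tc g j) * complex_of_real (\<beta> j)) \<le> ?a f j * ?a g j"
        by (simp only: mult_ac)
    qed
    also have "\<dots> \<le> nrm f * nrm g"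
    proof (rule power2_le_imp_le)
      have "(\<Sum>j<N. ?a f j * ?a g j)\<^sup>2 \<le> (\<Sum>j<N. (?a f j)\<^sup>2) * (\<Sum>j<N. (?a g j)\<^sup>2)"
        by (rule Cauchy_Schwarz_ineq_sum)
      also have "\<dots> \<le> (nrm f)\<^sup>2 * (nrm g)\<^sup>2"
        using assms by (intro mult_mono a2) (auto intro: sum_nonneg)
      finally show "(\<Sum>j<N. ?a f j * ?a g j)\<^sup>2 \<le> (nrm f * nrm g)\<^sup>2"
        by (simp add: power_mult_distrib)
      show "0 \<le> nrm f * nrm g" using assms norm_nonneg by simp
    qed
    finally show ?thesis .
  qed
  moreover have "(\<lambda>N. cmod (\<Sum>j<N. tc f j * cnj (tc g j) * complex_of_real (\<beta> j))) \<longlonglongrightarrow> cmod (ip f g)"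
    using inner_sums[OF assms] unfolding sums_def by (rule tendsto_norm)
  ultimately show ?thesis
    by (intro LIMSEQ_le_const2) auto
qed

lemma inner_commute:
  assumes "f \<in> H" "g \<in> H"
  shows "ip g f = cnj (ip f g)"
proof -
  have "(\<lambda>j. cnj (tc f j * cnj (tc g j) * complex_of_real (\<beta> j))) sums cnj (ip f g)"
    using inner_sums[OF assms] by (simp only: sums_cnj)
  then have "(\<lambda>j. tc g j * cnj (tc f j) * complex_of_real (\<beta> j)) sums cnj (ip f g)"
    by (simp add: mult_ac)
  with inner_sums[OF assms(2,1)] show ?thesis by (rule sums_unique2)
qed

lemma inner_add_left:
  assumes "f \<in> H" "g \<in> H" "h \<in> H"
  shows "ip (\<lambda>z. f z + g z) h = ip f h + ip g h"
proof (rule sums_unique2)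
  show "(\<lambda>j. tc (\<lambda>z. f z + g z) j * cnj (tc h j) * complex_of_real (\<beta> j)) sums ip (\<lambda>z. f z + g z) h"
    using assms by (intro inner_sums bergman_add)
  show "(\<lambda>j. tc (\<lambda>z. f z + g z) j * cnj (tc h j) * complex_of_real (\<beta> j)) sums (ip f h + ip g h)"
    using sums_add[OF inner_sums[OF assms(1,3)] inner_sums[OF assms(2,3)]] assms[THEN bergmanD(1)]
    by (simp add: taylor_coeff_add algebra_simps)
qed

lemma inner_cmult_left:
  assumes "f \<in> H" "h \<in> H"
  shows "ip (\<lambda>z. k * f z) h = k * ip f h"
proof (rule sums_unique2)
  show "(\<lambda>j. tc (\<lambda>z. k * f z) j * cnj (tc h j) * complex_of_real (\<beta> j)) sums ip (\<lambda>z. k * f z) h"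
    using assms by (intro inner_sums bergman_cmult)
  show "(\<lambda>j. tc (\<lambda>z. k * f z) j * cnj (tc h j) * complex_of_real (\<beta> j)) sums (k * ip f h)"
    using sums_mult[OF inner_sums[OF assms], of k] assms[THEN bergmanD(1)]
    by (simp add: taylor_coeff_cmult mult_ac)
qed

lemma inner_add_right:
  assumes "f \<in> H" "g \<in> H" "h \<in> H"
  shows "ip h (\<lambda>z. f z + g z) = ip h f + ip h g"
  using assms inner_commute[OF bergman_add[OF assms(1,2)] assms(3)] inner_commute[of f h]
    inner_commute[of g h] inner_add_left[OF assms] by simp

lemma inner_cmult_right:
  assumes "f \<in> H" "h \<in> H"
  shows "ip h (\<lambda>z. k * f z) = cnj k * ip h f"
  using assms inner_commute[OF bergman_cmult(1)[OF assms(1)] assms(2)] inner_commute[of f h]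
    inner_cmult_left[OF assms] by simp

section \<open>The reproducing kernel\<close>

lemma kernel_holomorphic: "K w holomorphic_on unit_disk" if "w \<in> unit_disk"
proof -
  have "(\<lambda>z. (1 - cnj w * z) powr (- complex_of_real (\<alpha> + 2))) holomorphic_on unit_disk"
    using that by (intro one_minus_powr_holomorphic) simp
  then show ?thesis
    by (rule holomorphic_transform) (simp add: bergman_kernel_def)
qed

text \<open>Binomial series: the coefficient \<open>pochhammer (\<alpha> + 2) j / fact j\<close> is
  the reciprocal of the weight.\<close>

lemma taylor_coeff_kernel: "tc (K w) j = cnj w ^ j / complex_of_real (\<beta> j)" if "w \<in> unit_disk"
proof -
  have "tc (K w) j = tc (\<lambda>z. (1 - cnj w * z) powr (- complex_of_real (\<alpha> + 2))) j"
    by (subst taylor_coeff_cong[of "K w"]) (auto simp: bergman_kernel_def)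
  also have "\<dots> = pochhammer (complex_of_real (\<alpha> + 2)) j * cnj w ^ j / fact j"
    using higher_deriv_one_minus_powr[of "cnj w" 0 j "complex_of_real (\<alpha> + 2)"] that
    by (simp add: taylor_coeff_def)
  also have "\<dots> = cnj w ^ j / complex_of_real (\<beta> j)"
    unfolding weight_eq pochhammer_of_real by simp
  finally show ?thesis .
qed

text \<open>The j-th term of the squared norm is the modulus of the j-th Taylor term of
  \<open>K w\<close> at the point \<open>w\<close> itself, so the norm is finite by absolute
  convergence inside the disk.\<close>

lemma kernel_in: "K w \<in> H" if w: "w \<in> unit_disk"
proof (rule bergmanI)
  have "summable (\<lambda>j. cmod (tc (K w) j * w ^ j))"
  proof -
    \<comment> \<open>Plain convergence at a radius strictly between \<open>cmod w\<close> and 1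
      gives absolute convergence at \<open>w\<close>.\<close>
    obtain r where r: "cmod w < r" "r < 1" using w dense[of "cmod w" 1] by auto
    then have "summable (\<lambda>j. tc (K w) j * complex_of_real r ^ j)"
      using taylor_sums[OF kernel_holomorphic[OF w], of "complex_of_real r"]
      by (auto simp: sums_iff) (metis (no_types, lifting) abs_of_nonneg norm_ge_zero order.strict_trans1 order_less_imp_le)
    then show ?thesis
      by (rule powser_insidea) (use r in auto)
  qed
  moreover have "cmod (tc (K w) j * w ^ j) = (cmod (tc (K w) j))\<^sup>2 * \<beta> j" for j
    using weight_pos[of j]
    by (simp add: taylor_coeff_kernel[OF w] norm_mult norm_divide norm_power power2_eq_square)
  ultimately show "summable (\<lambda>j. (cmod (tc (K w) j))\<^sup>2 * \<beta> j)" by simp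
qed (auto simp: kernel_holomorphic[OF w] bergman_kernel_def)

text \<open>The weight in the inner product cancels the one in the kernel coefficient, which leaves
  the Taylor series of \<open>f\<close> at \<open>w\<close>.\<close>

lemma reproducing: "ip f (K w) = f w" if "f \<in> H" "w \<in> unit_disk"
proof -
  have "(\<lambda>j. tc f j * w ^ j) sums ip f (K w)"
    using inner_sums[OF that(1) kernel_in[OF that(2)]] weight_pos
    by (simp add: taylor_coeff_kernel[OF that(2)] less_imp_neq[THEN not_sym])
  then show ?thesis
    using taylor_sums[OF bergmanD(1)[OF that(1)] that(2)] sums_unique2 by blast
qed

section \<open>Completeness and Riesz representation\<close>

text \<open>This is completeness of the space in coefficient form. The power series converges at
  \<open>z\<close> because its terms are dominated by the norm series of the sequence plus that of
  the kernel \<open>K z\<close>.\<close>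

lemma bergman_of_coeffs:
  assumes "summable (\<lambda>j. (cmod (a j))\<^sup>2 * \<beta> j)"
  obtains h where "h \<in> H" "tc h = a"
proof -
  define h where "h z = (if z \<in> unit_disk then \<Sum>j. a j * z ^ j else 0)" for z
  have "(\<lambda>j. a j * z ^ j) sums h z" if z: "z \<in> unit_disk" for z
  proof -
    have k: "summable (\<lambda>j. (cmod (tc (K z) j))\<^sup>2 * \<beta> j)"
      using bergmanD(3)[OF kernel_in[OF z]] .
    have "summable (\<lambda>j. (cmod (a j))\<^sup>2 * \<beta> j + (cmod (tc (K z) j))\<^sup>2 * \<beta> j)"
      by (intro summable_add assms k)
    moreover have "cmod (a j * z ^ j) \<le> (cmod (a j))\<^sup>2 * \<beta> j + (cmod (tc (K z) j))\<^sup>2 * \<beta> j" for j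
    proof -
      have b: "\<beta> j > 0" by (rule weight_pos)
      \<comment> \<open>The weight is divided so that \<open>?x * ?y\<close> is the term of the
        series while the square of \<open>?y\<close> is the j-th term of the squared norm of
        \<open>K z\<close>.\<close>
      let ?x = "cmod (a j) * sqrt (\<beta> j)" and ?y = "cmod z ^ j / sqrt (\<beta> j)"
      have "cmod (a j * z ^ j) = ?x * ?y" using b by (simp add: norm_mult norm_power)
      also have "\<dots> \<le> ?x\<^sup>2 + ?y\<^sup>2"
        using sum_squares_bound[of ?x ?y] zero_le_power2[of ?x] zero_le_power2[of ?y] by linarith
      also have "\<dots> = (cmod (a j))\<^sup>2 * \<beta> j + (cmod (tc (K z) j))\<^sup>2 * \<beta> j"
        using b by (simp add: taylor_coeff_kernel[OF z] power_mult_distrib power_divide norm_divide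
            norm_power power2_eq_square)
      finally show ?thesis .
    qed
    ultimately have "summable (\<lambda>j. a j * z ^ j)"
      by (rule summable_comparison_test')
    then show ?thesis using z by (simp add: h_def summable_sums)
  qed
  note h = power_series_holomorphic_and_coeff[OF this]
  have "h \<in> H"
  proof (rule bergmanI)
    show "h z = 0" if "z \<notin> unit_disk" for z using that by (simp add: h_def)
  qed (use h assms in simp_all)
  with h show thesis using that by blast
qed

text \<open>The values of \<open>L\<close> on monomials prescribe the coefficients of
  \<open>h\<close>. Testing \<open>L\<close> on truncations of the candidate shows that
  \<open>h\<close> lies in the space, and convergence of Taylor partial sums in norm extends the
  identity from polynomials to all \<open>f\<close>.\<close>

lemma Riesz_representation:
  assumes "bounded_functional \<alpha> L"
  obtains h where "h \<in> H" "\<And>f. f \<in> H \<Longrightarrow> L f = ip f h"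
proof -
  from assms have add: "\<And>f g. f \<in> H \<Longrightarrow> g \<in> H \<Longrightarrow> L (\<lambda>z. f z + g z) = L f + L g"
    and cm: "\<And>k f. f \<in> H \<Longrightarrow> L (\<lambda>z. k * f z) = k * L f"
    by (auto simp: bounded_functional_def)
  from assms obtain M0 where M0: "\<And>f. f \<in> H \<Longrightarrow> cmod (L f) \<le> M0 * nrm f"
    unfolding bounded_functional_def by blast
  \<comment> \<open>The absolute value keeps the bound, norms being nonnegative, and gives
    \<open>sqrt ?S \<le> M\<close> also when the sum \<open>?S\<close> vanishes.\<close>
  define M where "M = \<bar>M0\<bar>"
  have M: "cmod (L f) \<le> M * nrm f" if "f \<in> H" for f
    using M0[OF that] mult_right_mono[OF abs_ge_self norm_nonneg[OF that], of M0] by (simp add: M_def)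
  have M_nonneg: "M \<ge> 0" by (simp add: M_def)
  define e where "e j = disk_poly (\<lambda>i. if i = j then 1 else 0) (Suc j)" for j
  have e: "e j z = (if z \<in> unit_disk then z ^ j else 0)" for j z
    by (simp add: e_def disk_poly_def if_distrib[of "\<lambda>x. x * _"] cong: if_cong)
  have eH: "e j \<in> H" for j unfolding e_def by (rule disk_poly_in)
  have L_poly: "L (disk_poly b N) = (\<Sum>j<N. b j * L (e j))" for b N
  proof (induction N)
    case 0
    show ?case using cm[OF disk_poly_in, of 0 b 0] by (simp add: disk_poly_def[abs_def] cong: if_cong)
  next
    case (Suc N)
    have "disk_poly b (Suc N) = (\<lambda>z. disk_poly b N z + b N * e N z)"
      by (auto simp: disk_poly_def e)
    then show ?case
      using add[OF disk_poly_in bergman_cmult(1)[OF eH]] cm[OF eH] Suc by simp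
  qed
  \<comment> \<open>The coefficients forced by requiring \<open>L (e j)\<close> to be the inner
    product of \<open>e j\<close> with \<open>h\<close>.\<close>
  define a where "a j = cnj (L (e j)) / complex_of_real (\<beta> j)" for j
  have aL: "L (e j) = cnj (a j) * complex_of_real (\<beta> j)" for j
    using weight_pos[of j] by (simp add: a_def)
  \<comment> \<open>On the truncation with coefficients \<open>a\<close>, the functional takes the
    value \<open>?S\<close> while the norm is \<open>sqrt ?S\<close>; boundedness gives
    \<open>?S \<le> M * sqrt ?S\<close>.\<close>
  have "(\<Sum>j<N. (cmod (a j))\<^sup>2 * \<beta> j) \<le> M\<^sup>2" for N
  proof -
    let ?S = "\<Sum>j<N. (cmod (a j))\<^sup>2 * \<beta> j"
    have S0: "?S \<ge> 0" using weight_nonneg by (intro sum_nonneg) auto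
    have nS: "nrm (disk_poly a N) = sqrt ?S"
      using norm_disk_poly[of a N] norm_nonneg[OF disk_poly_in] by (metis real_sqrt_unique)
    have "L (disk_poly a N) = (\<Sum>j<N. complex_of_real ((cmod (a j))\<^sup>2 * \<beta> j))"
      unfolding L_poly aL 
      by (intro sum.cong refl) (simp only: of_real_mult complex_norm_square mult.assoc)
    then have "L (disk_poly a N) = complex_of_real ?S" by simp
    then have "cmod (L (disk_poly a N)) = ?S"
      using S0 by (simp add: norm_of_real del: of_real_sum)
    then have "?S \<le> M * sqrt ?S" using M[OF disk_poly_in, of a N] nS by simp
    then have "sqrt ?S * sqrt ?S \<le> M * sqrt ?S" using S0 by simp
    then have "sqrt ?S \<le> M"
      using M_nonneg S0 by (cases "?S = 0") (auto simp del: real_sqrt_mult_self intro: mult_right_le_imp_le)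
    then show ?thesis using S0 by (meson real_sqrt_le_iff sqrt_le_D)
  qed
  then have "summable (\<lambda>j. (cmod (a j))\<^sup>2 * \<beta> j)"
    by (intro summableI_nonneg_bounded[where x="M\<^sup>2"]) (auto simp: weight_nonneg)
  then obtain h where h: "h \<in> H" "tc h = a" by (rule bergman_of_coeffs)
  have "L f = ip f h" if f: "f \<in> H" for f
  proof -
    have 1: "(\<lambda>N. L (disk_poly (tc f) N)) \<longlonglongrightarrow> ip f h"
      using inner_sums[OF f h(1)] by (simp add: sums_def L_poly aL h(2) mult_ac)
    \<comment> \<open>The Taylor tail of \<open>f\<close>: its squared norm is the tail of a
      convergent series, so \<open>L\<close> tends to 0 along it.\<close>
    define d where "d N = (\<lambda>z. f z + (-1) * disk_poly (tc f) N z)" for N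
    have dH: "d N \<in> H" for N unfolding d_def by (intro bergman_add f bergman_cmult(1) disk_poly_in)
    have tcd: "tc (d N) j = (if j < N then 0 else tc f j)" for N j
    proof -
      have "tc (d N) j = tc f j + tc (\<lambda>z. (-1) * disk_poly (tc f) N z) j"
        unfolding d_def by (rule taylor_coeff_add[OF bergmanD(1)[OF f] bergmanD(1)[OF bergman_cmult(1)[OF disk_poly_in]]])
      also have "tc (\<lambda>z. (-1) * disk_poly (tc f) N z) j = (-1) * tc (disk_poly (tc f) N) j"
        by (rule taylor_coeff_cmult[OF disk_poly_holomorphic])
      finally show ?thesis by (simp add: taylor_coeff_disk_poly)
    qed
    let ?u = "\<lambda>j. (cmod (tc f j))\<^sup>2 * \<beta> j"
    have "(nrm (d N))\<^sup>2 = (\<Sum>j. ?u j) - (\<Sum>j<N. ?u j)" for N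
    proof -
      have "(\<lambda>j. ?u j - (if j \<in> {..<N} then ?u j else 0)) sums ((\<Sum>j. ?u j) - (\<Sum>j<N. ?u j))"
        by (intro sums_diff summable_sums bergmanD(3)[OF f] sums_If_finite_set) auto
      moreover have "(\<lambda>j. ?u j - (if j \<in> {..<N} then ?u j else 0)) = (\<lambda>j. (cmod (tc (d N) j))\<^sup>2 * \<beta> j)"
        by (auto simp: tcd)
      ultimately show ?thesis unfolding norm_power2[OF dH] by (simp add: sums_iff)
    qed
    moreover have "(\<lambda>N. (\<Sum>j. ?u j) - (\<Sum>j<N. ?u j)) \<longlonglongrightarrow> (\<Sum>j. ?u j) - (\<Sum>j. ?u j)"
      by (intro tendsto_intros summable_LIMSEQ bergmanD(3)[OF f])
    ultimately have "(\<lambda>N. (nrm (d N))\<^sup>2) \<longlonglongrightarrow> 0" by simp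
    then have "(\<lambda>N. sqrt ((nrm (d N))\<^sup>2)) \<longlonglongrightarrow> sqrt 0" by (intro tendsto_intros)
    then have "(\<lambda>N. nrm (d N)) \<longlonglongrightarrow> 0" using norm_nonneg[OF dH] by simp
    then have "(\<lambda>N. M * nrm (d N)) \<longlonglongrightarrow> 0" by (rule tendsto_mult_right_zero)
    then have "(\<lambda>N. L (d N)) \<longlonglongrightarrow> 0"
      by (rule Lim_null_comparison[rotated]) (auto intro!: always_eventually M dH)
    moreover have "L (d N) = L f - L (disk_poly (tc f) N)" for N
      unfolding d_def using add[OF f bergman_cmult(1)[OF disk_poly_in, of "-1"]] cm[OF disk_poly_in, of "-1"]
      by simp
    ultimately have "(\<lambda>N. L f - L (disk_poly (tc f) N)) \<longlonglongrightarrow> 0" by simp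
    then have "(\<lambda>N. L f - (L f - L (disk_poly (tc f) N))) \<longlonglongrightarrow> L f - 0"
      by (intro tendsto_intros)
    then have "(\<lambda>N. L (disk_poly (tc f) N)) \<longlonglongrightarrow> L f" by simp
    with 1 show ?thesis using LIMSEQ_unique by blast
  qed
  with h(1) show thesis using that by blast
qed

text \<open>Totality of the kernels: the value at \<open>w\<close> of the vector representing
  \<open>L\<close> is \<open>cnj (L (K w))\<close>, so that vector vanishes.\<close>

lemma bounded_functional_eq_0:
  assumes "bounded_functional \<alpha> L" "\<And>w. w \<in> unit_disk \<Longrightarrow> L (K w) = 0" "f \<in> H"
  shows "L f = 0"
proof -
  obtain h where h: "h \<in> H" "\<And>f. f \<in> H \<Longrightarrow> L f = ip f h"
    using Riesz_representation[OF assms(1)] by blast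
  have "h w = 0" if w: "w \<in> unit_disk" for w
  proof -
    have "h w = cnj (L (K w))"
      using h w by (simp add: reproducing[symmetric] inner_commute[of "K w" h] kernel_in)
    then show ?thesis using assms(2) w by simp
  qed
  then have "h = (\<lambda>z. 0 * h z)" using bergmanD(2)[OF h(1)] by auto
  then have "ip f h = 0" using inner_cmult_right[OF h(1) assms(3), of 0] by simp
  then show ?thesis using h assms(3) by simp
qed

end

section \<open>Bounded operators and adjoints\<close>

context bergman
begin

lemma bounded_operatorD:
  assumes "bounded_operator \<alpha> T"
  shows "\<And>f. f \<in> H \<Longrightarrow> T f \<in> H"
    and "\<And>f g. f \<in> H \<Longrightarrow> g \<in> H \<Longrightarrow> T (\<lambda>z. f z + g z) = (\<lambda>z. T f z + T g z)"
    and "\<And>k f. f \<in> H \<Longrightarrow> T (\<lambda>z. k * f z) = (\<lambda>z. k * T f z)"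
    and "\<exists>M. \<forall>f\<in>H. nrm (T f) \<le> M * nrm f"
  using assms unfolding bounded_operator_def by blast+

lemma bounded_functional_inner:
  assumes T: "bounded_operator \<alpha> T" and g: "g \<in> H"
  shows "bounded_functional \<alpha> (\<lambda>f. ip (T f) g)"
proof -
  note TD = bounded_operatorD[OF T]
  obtain M where M: "\<And>f. f \<in> H \<Longrightarrow> nrm (T f) \<le> M * nrm f" using TD(4) by blast
  have "cmod (ip (T f) g) \<le> (M * nrm g) * nrm f" if f: "f \<in> H" for f
  proof -
    have "cmod (ip (T f) g) \<le> nrm (T f) * nrm g" by (intro Cauchy_Schwarz TD f g)
    also have "\<dots> \<le> (M * nrm f) * nrm g" by (intro mult_right_mono M f norm_nonneg g)
    finally show ?thesis by (simp add: mult_ac)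
  qed
  then show ?thesis
    unfolding bounded_functional_def using TD(1-3) g by (auto simp: inner_add_left inner_cmult_left)
qed

lemma bounded_functional_diff:
  assumes "bounded_functional \<alpha> L1" "bounded_functional \<alpha> L2"
  shows "bounded_functional \<alpha> (\<lambda>f. L1 f - L2 f)"
proof -
  obtain M1 where M1: "\<And>f. f \<in> H \<Longrightarrow> cmod (L1 f) \<le> M1 * nrm f"
    using assms(1) unfolding bounded_functional_def by blast
  obtain M2 where M2: "\<And>f. f \<in> H \<Longrightarrow> cmod (L2 f) \<le> M2 * nrm f"
    using assms(2) unfolding bounded_functional_def by blast
  have "cmod (L1 f - L2 f) \<le> (M1 + M2) * nrm f" if f: "f \<in> H" for f
    using norm_triangle_ineq4[of "L1 f" "L2 f"] M1[OF f] M2[OF f] by (simp add: distrib_right)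
  then show ?thesis
    using assms unfolding bounded_functional_def
    by (intro conjI exI[of _ "M1 + M2"]) (auto simp: algebra_simps)
qed

lemma bounded_operator_id: "bounded_operator \<alpha> (\<lambda>f. f)"
  unfolding bounded_operator_def by (auto intro: exI[of _ 1])

text \<open>Settles uniqueness in the definite description: two candidates have the same inner
  product with every \<open>K w\<close>, hence the same value at every \<open>w\<close>.\<close>

lemma adjoint_eqI:
  assumes "h \<in> H" "\<And>f. f \<in> H \<Longrightarrow> ip (T f) g = ip f h"
  shows "hilbert_adjoint \<alpha> T g = h"
  unfolding hilbert_adjoint_def
proof (rule the_equality)
  fix h' assume h': "h' \<in> H \<and> (\<forall>f\<in>H. ip (T f) g = ip f h')"
  show "h' = h"
  proof (rule bergman_eqI)
    fix w assume w: "w \<in> unit_disk"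
    have "ip (K w) h' = ip (K w) h" using h' assms(2) kernel_in[OF w] by metis
    then have "ip h' (K w) = ip h (K w)"
      using h' assms(1) by (simp add: inner_commute[OF kernel_in[OF w]])
    then show "h' w = h w" using h' assms(1) w by (simp add: reproducing)
  qed (use h' assms in auto)
qed (use assms in auto)

lemma adjoint:
  assumes "bounded_operator \<alpha> T" "g \<in> H"
  shows "hilbert_adjoint \<alpha> T g \<in> H"
    and "\<And>f. f \<in> H \<Longrightarrow> ip (T f) g = ip f (hilbert_adjoint \<alpha> T g)"
proof -
  obtain h where h: "h \<in> H" "\<And>f. f \<in> H \<Longrightarrow> ip (T f) g = ip f h"
    using Riesz_representation[OF bounded_functional_inner[OF assms]] by blast
  then have eq: "hilbert_adjoint \<alpha> T g = h" by (rule adjoint_eqI)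
  show "hilbert_adjoint \<alpha> T g \<in> H" "\<And>f. f \<in> H \<Longrightarrow> ip (T f) g = ip f (hilbert_adjoint \<alpha> T g)"
    using h by (simp_all add: eq)
qed

end

section \<open>Weighted composition conjugations\<close>

lemma J_conj_holomorphic: "J_conj f holomorphic_on unit_disk"
  and taylor_coeff_J_conj: "taylor_coeff (J_conj f) = (\<lambda>j. cnj (taylor_coeff f j))"
  if "f holomorphic_on unit_disk"
proof -
  have s: "(\<lambda>j. cnj (taylor_coeff f j) * z ^ j) sums J_conj f z" if "z \<in> unit_disk" for z
  proof -
    have "(\<lambda>j. taylor_coeff f j * cnj z ^ j) sums f (cnj z)"
      using that \<open>f holomorphic_on unit_disk\<close> by (intro taylor_sums) auto
    then have "(\<lambda>j. cnj (taylor_coeff f j * cnj z ^ j)) sums cnj (f (cnj z))"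
      by (simp only: sums_cnj)
    then show ?thesis by (simp add: J_conj_def)
  qed
  show "J_conj f holomorphic_on unit_disk" "taylor_coeff (J_conj f) = (\<lambda>j. cnj (taylor_coeff f j))"
    using power_series_holomorphic_and_coeff[OF s] by auto
qed

text \<open>
  The first identity says that the function \<open>\<omega> \<cdot> (J K\<^sub>w \<circ> \<theta>)\<close> is symmetric in its
  argument and in \<open>w\<close>; the other two say that the operator squares to the identity.
\<close>

locale bergman_conj = bergman +
  fixes \<omega> \<theta> :: "complex \<Rightarrow> complex"
  assumes omega_holo: "\<omega> holomorphic_on unit_disk"
    and theta_holo: "\<theta> holomorphic_on unit_disk"
    and theta_disk: "\<And>z. z \<in> unit_disk \<Longrightarrow> \<theta> z \<in> unit_disk"
    and kernel_sym: "\<And>z w. z \<in> unit_disk \<Longrightarrow> w \<in> unit_disk \<Longrightarrow>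
      \<omega> z * (1 - w * \<theta> z) powr (- complex_of_real (\<alpha> + 2))
      = \<omega> w * (1 - z * \<theta> w) powr (- complex_of_real (\<alpha> + 2))"
    and theta_invol: "\<And>z. z \<in> unit_disk \<Longrightarrow> \<theta> (cnj (\<theta> z)) = cnj z"
    and omega_invol: "\<And>z. z \<in> unit_disk \<Longrightarrow> \<omega> z * cnj (\<omega> (cnj (\<theta> z))) = 1"
begin

abbreviation "Cj \<equiv> weighted_comp_op \<omega> \<theta> \<circ> J_conj"

lemma Cj_apply: "Cj f z = (if z \<in> unit_disk then \<omega> z * cnj (f (cnj (\<theta> z))) else 0)"
  by (simp add: weighted_comp_op_def J_conj_def)

lemma cnj_theta_disk: "cnj (\<theta> z) \<in> unit_disk" if "z \<in> unit_disk"
  using theta_disk[OF that] by simp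

lemma Cj_holo: "Cj f holomorphic_on unit_disk" if "f holomorphic_on unit_disk"
proof -
  have "(\<lambda>z. \<omega> z * (J_conj f \<circ> \<theta>) z) holomorphic_on unit_disk"
    by (intro holomorphic_intros omega_holo holomorphic_on_compose_gen[OF theta_holo
          J_conj_holomorphic[OF that]]) (use theta_disk in auto)
  then show ?thesis
    by (rule holomorphic_transform) (simp add: weighted_comp_op_def)
qed

lemma Cj_Cj: "Cj (Cj f) = f" if "\<And>z. z \<notin> unit_disk \<Longrightarrow> f z = 0"
proof
  fix z
  show "Cj (Cj f) z = f z"
  proof (cases "z \<in> unit_disk")
    case True
    have "Cj (Cj f) z = (\<omega> z * cnj (\<omega> (cnj (\<theta> z)))) * f (cnj (\<theta> (cnj (\<theta> z))))"
      using True cnj_theta_disk[OF True] by (simp add: Cj_apply del: comp_apply)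
    then show ?thesis using True by (simp add: omega_invol theta_invol del: comp_apply)
  next
    case False
    then show ?thesis using that by (simp add: Cj_apply del: comp_apply)
  qed
qed

section \<open>The matrix of the conjugation and its isometry\<close>

text \<open>Column \<open>j\<close> holds the coefficients of the image of the monomial of degree
  \<open>j\<close> under \<open>Cj\<close>; the two conjugations cancel on a monomial, which leaves
  \<open>\<omega> z * \<theta> z ^ j\<close>.\<close>

definition A :: "nat \<Rightarrow> nat \<Rightarrow> complex" where
  "A m j = tc (\<lambda>z. \<omega> z * \<theta> z ^ j) m"

lemma omega_theta_holo: "(\<lambda>z. \<omega> z * \<theta> z ^ j) holomorphic_on unit_disk"
  by (intro holomorphic_intros omega_holo theta_holo)

text \<open>Boundedness of \<open>Cj\<close> is yet to be derived from the matrix, so termwise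
  application is justified by function theory instead: the series converges uniformly near 0, and
  derivatives at 0 pass to uniform limits of holomorphic functions.\<close>

lemma coeff_Cj_sums:
  assumes f: "f holomorphic_on unit_disk"
  shows "(\<lambda>j. cnj (tc f j) * A m j) sums tc (Cj f) m"
proof -
  \<comment> \<open>Any compact disk about 0 inside the unit disk would do; compactness keeps
    \<open>cmod (\<theta> z)\<close> at most some \<open>r < 1\<close>, where the Taylor series of
    \<open>f\<close> converges absolutely.\<close>
  let ?B = "cball (0::complex) (1/2)"
  have sub: "?B \<subseteq> unit_disk" by auto
  have cont: "continuous_on ?B \<theta>" "continuous_on ?B \<omega>"
    using holomorphic_on_imp_continuous_on[OF theta_holo] holomorphic_on_imp_continuous_on[OF omega_holo]
      continuous_on_subset[OF _ sub] by blast+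
  obtain x where x: "x \<in> ?B" "\<And>z. z \<in> ?B \<Longrightarrow> cmod (\<theta> z) \<le> cmod (\<theta> x)"
    using continuous_attains_sup[OF _ _ continuous_on_norm[OF cont(1)]] by auto
  obtain y where y: "y \<in> ?B" "\<And>z. z \<in> ?B \<Longrightarrow> cmod (\<omega> z) \<le> cmod (\<omega> y)"
    using continuous_attains_sup[OF _ _ continuous_on_norm[OF cont(2)]] by auto
  define r where "r = cmod (\<theta> x)"
  have "r < 1" using theta_disk x sub by (auto simp: r_def)
  then obtain r' where r': "r < r'" "r' < 1" using dense by blast
  have "r \<ge> 0" by (simp add: r_def)
  have "summable (\<lambda>j. tc f j * complex_of_real r' ^ j)"
    using taylor_sums[OF f, of "complex_of_real r'"] r' \<open>r \<ge> 0\<close> by (auto simp: sums_iff)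
  then have "summable (\<lambda>j. cmod (tc f j * complex_of_real r ^ j))"
    by (rule powser_insidea) (use r' \<open>r \<ge> 0\<close> in auto)
  then have M: "summable (\<lambda>j. cmod (\<omega> y) * cmod (tc f j * complex_of_real r ^ j))"
    by (rule summable_mult)
  let ?g = "\<lambda>j z. cnj (tc f j) * (\<omega> z * \<theta> z ^ j)"
  have g_le: "cmod (?g j z) \<le> cmod (\<omega> y) * cmod (tc f j * complex_of_real r ^ j)" if "z \<in> ?B" for j z
  proof -
    have "cmod (?g j z) = cmod (\<omega> z) * (cmod (tc f j) * cmod (\<theta> z) ^ j)"
      by (simp add: norm_mult norm_power mult_ac)
    also have "\<dots> \<le> cmod (\<omega> y) * (cmod (tc f j) * r ^ j)"
      using x(2)[OF that] y(2)[OF that] unfolding r_def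
      by (intro mult_mono power_mono) auto
    finally show ?thesis using \<open>r \<ge> 0\<close> by (simp add: norm_mult norm_power)
  qed
  have "uniform_limit ?B (\<lambda>k z. \<Sum>j<k. ?g j z) (\<lambda>z. \<Sum>j. ?g j z) sequentially"
    by (rule Weierstrass_m_test[OF g_le M])
  then have "uniform_limit (ball 0 (1/2)) (\<lambda>k z. \<Sum>j<k. ?g j z) (\<lambda>z. \<Sum>j. ?g j z) sequentially"
    by (rule uniform_limit_on_subset) auto
  then have "uniform_limit (ball 0 (1/2)) (\<lambda>k z. \<Sum>j<k. ?g j z) (Cj f) sequentially"
  proof (rule uniform_limit_cong[THEN iffD1, rotated 2])
    show "(\<Sum>j. ?g j z) = Cj f z" if "z \<in> ball 0 (1/2)" for z
    proof -
      have z: "z \<in> unit_disk" using that by auto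
      have "(\<lambda>j. cnj (tc f j) * \<theta> z ^ j) sums J_conj f (\<theta> z)"
        using taylor_sums[OF J_conj_holomorphic[OF f] theta_disk[OF z]] by (simp add: taylor_coeff_J_conj[OF f])
      then have "(\<lambda>j. \<omega> z * (cnj (tc f j) * \<theta> z ^ j)) sums (\<omega> z * J_conj f (\<theta> z))"
        by (rule sums_mult)
      then have "(\<lambda>j. ?g j z) sums Cj f z"
        using z by (simp add: weighted_comp_op_def mult_ac)
      then show ?thesis by (simp add: sums_iff)
    qed
  qed auto
  then have "(\<lambda>k. (deriv ^^ m) (\<lambda>z. \<Sum>j<k. ?g j z) 0) \<longlonglongrightarrow> (deriv ^^ m) (Cj f) 0"
  proof (rule higher_deriv_complex_uniform_limit)
    show "\<forall>\<^sub>F k in sequentially. (\<lambda>z. \<Sum>j<k. ?g j z) holomorphic_on ball 0 (1/2)"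
      by (intro always_eventually allI holomorphic_intros holomorphic_on_subset[OF omega_holo]
          holomorphic_on_subset[OF theta_holo]) auto
  qed auto
  then have "(\<lambda>k. tc (\<lambda>z. \<Sum>j<k. ?g j z) m) \<longlonglongrightarrow> tc (Cj f) m"
    unfolding taylor_coeff_def by (rule tendsto_divide) auto
  moreover have "tc (\<lambda>z. \<Sum>j<k. ?g j z) m = (\<Sum>j<k. cnj (tc f j) * A m j)" for k
  proof -
    have "tc (\<lambda>z. \<Sum>j<k. ?g j z) m = (\<Sum>j<k. tc (?g j) m)"
      by (rule taylor_coeff_sum) (intro holomorphic_intros omega_holo theta_holo)
    also have "\<dots> = (\<Sum>j<k. cnj (tc f j) * A m j)"
      by (intro sum.cong refl) (simp add: A_def taylor_coeff_cmult[OF omega_theta_holo])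
    finally show ?thesis .
  qed
  ultimately show ?thesis by (simp add: sums_def)
qed

text \<open>This is \<open>kernel_sym\<close> once complex conjugation has passed through the
  principal power, which is legitimate because the base has positive real part.\<close>

lemma Cj_kernel:
  assumes w: "w \<in> unit_disk"
  shows "Cj (K w) = (\<lambda>z. \<omega> w * K (cnj (\<theta> w)) z)"
proof
  fix z
  show "Cj (K w) z = \<omega> w * K (cnj (\<theta> w)) z"
  proof (cases "z \<in> unit_disk")
    case True
    have "Re (1 - cnj w * cnj (\<theta> z)) > 0"
      using w theta_disk[OF True] by (intro one_minus_mult_notin_nonpos_Reals) auto
    then have "cnj (K w (cnj (\<theta> z))) = (1 - w * \<theta> z) powr (- complex_of_real (\<alpha> + 2))"
      using cnj_theta_disk[OF True] by (simp add: bergman_kernel_def cnj_powr less_imp_le)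
    then have "Cj (K w) z = \<omega> z * (1 - w * \<theta> z) powr (- complex_of_real (\<alpha> + 2))"
      using True by (simp add: Cj_apply del: comp_apply)
    also have "\<dots> = \<omega> w * (1 - z * \<theta> w) powr (- complex_of_real (\<alpha> + 2))"
      by (rule kernel_sym[OF True w])
    finally show ?thesis using True by (simp add: bergman_kernel_def mult.commute)
  qed (simp add: weighted_comp_op_def bergman_kernel_def)
qed

text \<open>Coefficient \<open>m\<close> of \<open>Cj (K w)\<close> is computed twice as a power
  series in \<open>w\<close>: through the matrix its coefficients are
  \<open>A m j / \<beta> j\<close>, through \<open>Cj_kernel\<close> they are
  \<open>A j m / \<beta> m\<close>.\<close>

lemma A_symmetric: "A m j * complex_of_real (\<beta> m) = A j m * complex_of_real (\<beta> j)"
proof -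
  have s: "(\<lambda>j. (A m j / complex_of_real (\<beta> j)) * w ^ j) sums ((1 / complex_of_real (\<beta> m)) * (\<omega> w * \<theta> w ^ m))"
    if w: "w \<in> unit_disk" for w
  proof -
    have "tc (Cj (K w)) m = \<omega> w * tc (K (cnj (\<theta> w))) m"
      unfolding Cj_kernel[OF w] by (rule taylor_coeff_cmult[OF kernel_holomorphic[OF cnj_theta_disk[OF w]]])
    then have "tc (Cj (K w)) m = (1 / complex_of_real (\<beta> m)) * (\<omega> w * \<theta> w ^ m)"
      by (simp add: taylor_coeff_kernel[OF cnj_theta_disk[OF w]])
    moreover have "(\<lambda>j. cnj (tc (K w) j) * A m j) = (\<lambda>j. (A m j / complex_of_real (\<beta> j)) * w ^ j)"
      by (simp add: taylor_coeff_kernel[OF w] mult.commute)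
    ultimately show ?thesis using coeff_Cj_sums[OF kernel_holomorphic[OF w], of m] by simp
  qed
  have "A m j / complex_of_real (\<beta> j) = (1 / complex_of_real (\<beta> m)) * A j m"
    using power_series_holomorphic_and_coeff(2)[OF s] taylor_coeff_cmult[OF omega_theta_holo]
    by (metis A_def)
  then show ?thesis using weight_pos[of m] weight_pos[of j] by (simp add: field_simps)
qed

text \<open>Coefficient \<open>m\<close> of \<open>Cj (Cj e)\<close> for the monomial
  \<open>e\<close> of degree \<open>i\<close>: the matrix times its entrywise conjugate is the
  identity.\<close>

lemma A_involution: "(\<lambda>j. cnj (A j i) * A m j) sums (if m = i then 1 else 0)"
proof -
  define e where "e = disk_poly (\<lambda>j. if j = i then 1 else 0) (Suc i)"
  have e: "e z = z ^ i" if "z \<in> unit_disk" for z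
    using that by (simp add: e_def disk_poly_def if_distrib[of "\<lambda>x. x * _"] cong: if_cong)
  have e0: "e z = 0" if "z \<notin> unit_disk" for z using that by (simp add: e_def disk_poly_def)
  have eh: "e holomorphic_on unit_disk" unfolding e_def by (rule disk_poly_holomorphic)
  have "tc (Cj e) = tc (\<lambda>z. \<omega> z * \<theta> z ^ i)"
    by (rule taylor_coeff_cong) (simp add: Cj_apply e[OF cnj_theta_disk] del: comp_apply)
  then have "(\<lambda>j. cnj (A j i) * A m j) sums tc (Cj (Cj e)) m"
    using coeff_Cj_sums[OF Cj_holo[OF eh], of m] by (simp add: A_def)
  moreover have "tc (Cj (Cj e)) m = (if m = i then 1 else 0)"
    using Cj_Cj[of e] e0 by (simp add: e_def taylor_coeff_disk_poly del: comp_apply)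
  ultimately show ?thesis by simp
qed

text \<open>Isometry on polynomials. In the expanded square, \<open>A_symmetric\<close> trades
  \<open>A m i\<close> with weight \<open>\<beta> m\<close> for \<open>A i m\<close> with weight
  \<open>\<beta> i\<close>; the sum over \<open>m\<close> is then an entry of the identity by
  \<open>A_involution\<close>. Finiteness of \<open>k\<close> makes the interchange of sums
  harmless.\<close>

lemma A_isometric:
  "(\<lambda>m. (cmod (\<Sum>j<k. b j * A m j))\<^sup>2 * \<beta> m) sums (\<Sum>j<k. (cmod (b j))\<^sup>2 * \<beta> j)"
proof -
  let ?t = "\<lambda>i j m. b i * cnj (b j) * complex_of_real (\<beta> i) * (cnj (A m j) * A i m)"
  have summand: "complex_of_real ((cmod (\<Sum>j<k. b j * A m j))\<^sup>2 * \<beta> m) = (\<Sum>i<k. \<Sum>j<k. ?t i j m)" for m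
  proof -
    have "complex_of_real ((cmod (\<Sum>j<k. b j * A m j))\<^sup>2 * \<beta> m)
        = (\<Sum>i<k. b i * A m i) * (\<Sum>j<k. cnj (b j) * cnj (A m j)) * complex_of_real (\<beta> m)"
      unfolding of_real_mult complex_norm_square by simp
    also have "\<dots> = (\<Sum>i<k. \<Sum>j<k. (b i * A m i) * (cnj (b j) * cnj (A m j)) * complex_of_real (\<beta> m))"
      by (simp only: sum_product) (simp only: sum_distrib_right)
    also have "\<dots> = (\<Sum>i<k. \<Sum>j<k. b i * cnj (b j) * cnj (A m j) * (A m i * complex_of_real (\<beta> m)))"
      by (simp only: mult_ac)
    also have "\<dots> = (\<Sum>i<k. \<Sum>j<k. ?t i j m)"
      unfolding A_symmetric by (simp only: mult_ac)
    finally show ?thesis .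
  qed
  have "(\<lambda>m. \<Sum>i<k. \<Sum>j<k. ?t i j m) sums
      (\<Sum>i<k. \<Sum>j<k. b i * cnj (b j) * complex_of_real (\<beta> i) * (if i = j then 1 else 0))"
    by (intro sums_sum sums_mult A_involution)
  also have "(\<Sum>i<k. \<Sum>j<k. b i * cnj (b j) * complex_of_real (\<beta> i) * (if i = j then 1 else 0))
      = (\<Sum>i<k. b i * cnj (b i) * complex_of_real (\<beta> i))"
    by (intro sum.cong refl) (simp add: if_distrib[of "\<lambda>x. _ * x"] cong: if_cong)
  also have "\<dots> = complex_of_real (\<Sum>j<k. (cmod (b j))\<^sup>2 * \<beta> j)"
    unfolding of_real_sum of_real_mult complex_norm_square ..
  finally show ?thesis
    unfolding summand[symmetric] sums_of_real_iff .
qed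

text \<open>Output and input are truncated separately. For \<open>k\<close> input and
  \<open>M\<close> output coefficients \<open>A_isometric\<close> bounds the sum by the squared norm
  of \<open>f\<close>; then \<open>k\<close> tends to infinity with \<open>M\<close> fixed, and
  \<open>M\<close> is arbitrary.\<close>

lemma Cj_in: "Cj f \<in> H" and Cj_norm_le: "nrm (Cj f) \<le> nrm f" if f: "f \<in> H"
proof -
  have le: "(\<Sum>m<M. (cmod (tc (Cj f) m))\<^sup>2 * \<beta> m) \<le> (nrm f)\<^sup>2" for M
  proof (rule LIMSEQ_le_const2)
    show "(\<lambda>k. \<Sum>m<M. (cmod (\<Sum>j<k. cnj (tc f j) * A m j))\<^sup>2 * \<beta> m)
        \<longlonglongrightarrow> (\<Sum>m<M. (cmod (tc (Cj f) m))\<^sup>2 * \<beta> m)"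
      using coeff_Cj_sums[OF bergmanD(1)[OF f]] unfolding sums_def by (intro tendsto_intros)
    have "(\<Sum>m<M. (cmod (\<Sum>j<k. cnj (tc f j) * A m j))\<^sup>2 * \<beta> m) \<le> (nrm f)\<^sup>2" for k
    proof -
      have "(\<Sum>m<M. (cmod (\<Sum>j<k. cnj (tc f j) * A m j))\<^sup>2 * \<beta> m)
          \<le> (\<Sum>j<k. (cmod (cnj (tc f j)))\<^sup>2 * \<beta> j)"
        unfolding sums_unique[OF A_isometric[of "\<lambda>j. cnj (tc f j)" k]]
        by (rule sum_le_suminf[OF sums_summable[OF A_isometric]]) (auto simp: weight_nonneg)
      also have "\<dots> \<le> (nrm f)\<^sup>2" using sum_le_norm_power2[OF f] by simp
      finally show ?thesis .
    qed
    then show "\<exists>N. \<forall>k\<ge>N. (\<Sum>m<M. (cmod (\<Sum>j<k. cnj (tc f j) * A m j))\<^sup>2 * \<beta> m) \<le> (nrm f)\<^sup>2"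
      by blast
  qed
  have summ: "summable (\<lambda>m. (cmod (tc (Cj f) m))\<^sup>2 * \<beta> m)"
    by (rule summableI_nonneg_bounded[OF _ le]) (simp add: weight_nonneg)
  show in_H: "Cj f \<in> H"
    by (rule bergmanI[OF Cj_holo[OF bergmanD(1)[OF f]] _ summ]) (simp add: weighted_comp_op_def)
  have "(nrm (Cj f))\<^sup>2 \<le> (nrm f)\<^sup>2"
    unfolding norm_power2[OF in_H] by (rule suminf_le_const[OF summ le])
  then show "nrm (Cj f) \<le> nrm f" using norm_nonneg[OF f] by (rule power2_le_imp_le)
qed

lemma Cj_Cj_bergman: "Cj (Cj f) = f" if "f \<in> H"
  using bergmanD(2)[OF that] by (rule Cj_Cj)

text \<open>The inequality is applied to \<open>f\<close> and to \<open>Cj f\<close>, and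
  \<open>Cj\<close> is an involution.\<close>

lemma Cj_norm: "nrm (Cj f) = nrm f" if "f \<in> H"
  using Cj_norm_le[OF that] Cj_norm_le[OF Cj_in[OF that]] unfolding Cj_Cj_bergman[OF that] by simp

lemma Cj_add: "Cj (\<lambda>z. f z + g z) = (\<lambda>z. Cj f z + Cj g z)"
  and Cj_cmult: "Cj (\<lambda>z. k * f z) = (\<lambda>z. cnj k * Cj f z)"
  by (auto simp: Cj_apply algebra_simps simp del: comp_apply)

lemma conjugation_Cj: "conjugation \<alpha> Cj"
  unfolding conjugation_def using Cj_in Cj_norm Cj_Cj_bergman Cj_add Cj_cmult by blast

section \<open>Complex symmetry tested on kernels\<close>

text \<open>Both \<open>Cj\<close> and the second slot of \<open>ip\<close> are conjugate-linear, so
  the composite is linear.\<close>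

lemma bounded_functional_inner_Cj:
  assumes "h \<in> H" shows "bounded_functional \<alpha> (\<lambda>f. ip h (Cj f))"
proof -
  have "cmod (ip h (Cj f)) \<le> nrm h * nrm f" if "f \<in> H" for f
    using Cauchy_Schwarz[OF assms Cj_in[OF that]] Cj_norm[OF that] by simp
  then show ?thesis
    unfolding bounded_functional_def Cj_add Cj_cmult
    using assms Cj_in by (auto simp: inner_add_right inner_cmult_right simp del: comp_apply)
qed

text \<open>After conjugation the claim says that a bounded linear functional of \<open>f\<close>
  vanishes, so it suffices to take \<open>f\<close> to be a kernel, where \<open>Cj_kernel\<close>
  and the reproducing property apply.\<close>

lemma inner_Cj_swap: "ip (Cj f) g = ip (Cj g) f" if f: "f \<in> H" and g: "g \<in> H"
proof -
  have "ip g (Cj f) - ip f (Cj g) = 0"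
  proof (rule bounded_functional_eq_0[OF bounded_functional_diff[OF bounded_functional_inner_Cj[OF g]
          bounded_functional_inner[OF bounded_operator_id Cj_in[OF g]]] _ f])
    fix w assume w: "w \<in> unit_disk"
    have "ip g (Cj (K w)) = cnj (\<omega> w) * g (cnj (\<theta> w))"
      unfolding Cj_kernel[OF w] using g cnj_theta_disk[OF w]
      by (simp add: inner_cmult_right kernel_in reproducing)
    also have "\<dots> = cnj (Cj g w)" using w by (simp add: Cj_apply del: comp_apply)
    also have "\<dots> = ip (K w) (Cj g)"
      using reproducing[OF Cj_in[OF g] w] inner_commute[OF Cj_in[OF g] kernel_in[OF w]] by simp
    finally show "ip g (Cj (K w)) - ip (K w) (Cj g) = 0" by simp
  qed
  then show ?thesis
    using inner_commute[OF g Cj_in[OF f]] inner_commute[OF f Cj_in[OF g]] by simp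
qed

text \<open>As \<open>Cj\<close> is an involution, the symmetry says that the adjoint composed with
  \<open>Cj\<close> equals \<open>Cj\<close> composed with \<open>T\<close>. By
  \<open>inner_Cj_swap\<close> this is symmetry of the bilinear form
  \<open>ip (T f) (Cj g)\<close>.\<close>

lemma complex_symmetric_iff_kernels:
  assumes T: "bounded_operator \<alpha> T"
  shows "complex_symmetric \<alpha> Cj T \<longleftrightarrow>
    (\<forall>u\<in>unit_disk. \<forall>v\<in>unit_disk. ip (T (K v)) (Cj (K u)) = ip (T (K u)) (Cj (K v)))"
proof
  note TH = bounded_operatorD(1)[OF T]
  assume cs: "complex_symmetric \<alpha> Cj T"
  show "\<forall>u\<in>unit_disk. \<forall>v\<in>unit_disk. ip (T (K v)) (Cj (K u)) = ip (T (K u)) (Cj (K v))"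
  proof (intro ballI)
    fix u v assume u: "u \<in> unit_disk" and v: "v \<in> unit_disk"
    note Ku = kernel_in[OF u] and Kv = kernel_in[OF v]
    note adj = adjoint[OF T Cj_in[OF Ku]]
    have "Cj (hilbert_adjoint \<alpha> T (Cj (K u))) = T (K u)"
      using cs Ku by (simp add: complex_symmetric_def)
    then have eq: "hilbert_adjoint \<alpha> T (Cj (K u)) = Cj (T (K u))"
      using Cj_Cj_bergman[OF adj(1)] by simp
    have "ip (T (K v)) (Cj (K u)) = ip (K v) (Cj (T (K u)))"
      using adj(2)[OF Kv] by (simp only: eq)
    also have "\<dots> = cnj (ip (Cj (T (K u))) (K v))"
      by (rule inner_commute[OF Cj_in[OF TH[OF Ku]] Kv])
    also have "\<dots> = cnj (ip (Cj (K v)) (T (K u)))"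
      by (simp only: inner_Cj_swap[OF TH[OF Ku] Kv])
    also have "\<dots> = ip (T (K u)) (Cj (K v))"
      by (rule inner_commute[OF Cj_in[OF Kv] TH[OF Ku], symmetric])
    finally show "ip (T (K v)) (Cj (K u)) = ip (T (K u)) (Cj (K v))" .
  qed
next
  note TH = bounded_operatorD(1)[OF T]
  assume ker: "\<forall>u\<in>unit_disk. \<forall>v\<in>unit_disk. ip (T (K v)) (Cj (K u)) = ip (T (K u)) (Cj (K v))"
  have bf: "bounded_functional \<alpha> (\<lambda>f. ip (T f) (Cj g) - ip (T g) (Cj f))" if "g \<in> H" for g
    by (intro bounded_functional_diff bounded_functional_inner bounded_functional_inner_Cj T Cj_in TH that)
  \<comment> \<open>Symmetry is extended from kernels to the whole space one argument at a time,
    since \<open>bounded_functional_eq_0\<close> handles a single linear variable.\<close>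
  have step: "ip (T f) (Cj (K v)) - ip (T (K v)) (Cj f) = 0" if "f \<in> H" "v \<in> unit_disk" for f v
    by (rule bounded_functional_eq_0[OF bf[OF kernel_in[OF that(2)]] _ that(1)])
       (use ker that in auto)
  have sym: "ip (T f) (Cj g) - ip (T g) (Cj f) = 0" if "f \<in> H" "g \<in> H" for f g
    by (rule bounded_functional_eq_0[OF bf[OF that(2)] _ that(1)]) (use step[OF that(2)] in auto)
  have "Cj (hilbert_adjoint \<alpha> T (Cj f)) = T f" if f: "f \<in> H" for f
  proof -
    have "hilbert_adjoint \<alpha> T (Cj f) = Cj (T f)"
    proof (rule adjoint_eqI)
      show "Cj (T f) \<in> H" by (intro Cj_in TH f)
      fix g assume g: "g \<in> H"
      have "ip (T g) (Cj f) = ip (T f) (Cj g)" using sym[OF f g] by simp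
      also have "\<dots> = cnj (ip (Cj g) (T f))"
        by (rule inner_commute[OF Cj_in[OF g] TH[OF f]])
      also have "\<dots> = cnj (ip (Cj (T f)) g)"
        by (simp only: inner_Cj_swap[OF TH[OF f] g])
      also have "\<dots> = ip g (Cj (T f))"
        by (rule inner_commute[OF Cj_in[OF TH[OF f]] g, symmetric])
      finally show "ip (T g) (Cj f) = ip g (Cj (T f))" .
    qed
    then show ?thesis using Cj_Cj_bergman[OF TH[OF f]] by simp
  qed
  then show "complex_symmetric \<alpha> Cj T"
    unfolding complex_symmetric_def using conjugation_Cj T by blast
qed

end

section \<open>The functional equation\<close>

text \<open>The constant \<open>c\<close> of the target form appears as \<open>\<phi> 0\<close>,
  since evaluation at 0 forces this value; membership in the disk then comes for free.\<close>

lemma functional_equation_solution: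
  fixes \<psi> \<phi> :: "complex \<Rightarrow> complex" and s :: complex
  assumes n: "n > 0" and s: "s \<noteq> 0"
    and \<phi>_holo: "\<phi> holomorphic_on unit_disk"
    and \<phi>_sub: "\<phi> ` unit_disk \<subseteq> unit_disk"
    and \<psi>_nz: "\<exists>z\<in>unit_disk. \<psi> z \<noteq> 0"
    and \<phi>_nonconst: "\<not> \<phi> constant_on unit_disk"
    and fe: "\<forall>x\<in>unit_disk. \<forall>y\<in>unit_disk.
      \<psi> x * y ^ n * (1 - y * \<phi> x) powr (- s) = \<psi> y * x ^ n * (1 - x * \<phi> y) powr (- s)"
  shows "\<exists>a b. a \<noteq> 0 \<and> b \<noteq> 0 \<and>
    (\<forall>z\<in>unit_disk. \<phi> z = \<phi> 0 + b * z / (1 - \<phi> 0 * z)) \<and>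
    (\<forall>z\<in>unit_disk. \<psi> z = a * z ^ n * (1 - \<phi> 0 * z) powr (- s))"
proof -
  note eq = fe[rule_format]
  have \<phi>_disk: "\<phi> z \<in> unit_disk" if "z \<in> unit_disk" for z
    using \<phi>_sub that by blast
  define c where "c = \<phi> 0"
  have c: "c \<in> unit_disk" unfolding c_def by (rule \<phi>_disk) simp
  note nonpos = one_minus_mult_notin_nonpos_Reals
  have nz: "1 - x * \<phi> y \<noteq> 0" if "x \<in> unit_disk" "y \<in> unit_disk" for x y
    using nonpos(3)[OF that(1) \<phi>_disk[OF that(2)]] .
  have powr_cancel: "u powr s * u powr (- s) = 1" if "u \<noteq> 0" for u
    using that by (simp add: powr_minus)
  \<comment> \<open>At \<open>x = 0\<close>, \<open>y = 1/2\<close> the right side vanishes because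
    \<open>n > 0\<close>, while the factors next to \<open>\<psi> 0\<close> do not.\<close>
  have "\<psi> 0 = 0"
    using eq[of 0 "1/2"] n nz[of "1/2" 0] by (auto simp: power_0_left)
  \<comment> \<open>Dividing by \<open>x ^ n\<close> removes the power factors from the equation;
    only values off 0 matter.\<close>
  define g where "g x = \<psi> x / x ^ n" for x
  have g_eq: "g y = g x * (1 - y * \<phi> x) powr (- s) * (1 - x * \<phi> y) powr s"
    if "x \<in> unit_disk" "y \<in> unit_disk" "x \<noteq> 0" "y \<noteq> 0" for x y
  proof -
    have "g x * (1 - y * \<phi> x) powr (- s) = g y * (1 - x * \<phi> y) powr (- s)"
      using eq[OF that(1,2)] that(3,4) by (simp add: g_def field_simps)
    then show ?thesis
      using powr_cancel[OF nz[OF that(1,2)]] by (simp add: mult.assoc mult.commute)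
  qed
  have \<phi>_tendsto: "(\<phi> \<longlongrightarrow> c) (at 0)"
    using holomorphic_on_imp_continuous_on[OF \<phi>_holo] unfolding c_def
    by (metis continuous_on_def at_within_open centre_in_ball open_ball zero_less_one)
  \<comment> \<open>With \<open>x\<close> fixed, the equation itself shows that \<open>g\<close> has
    a limit at 0. By uniqueness of the limit, \<open>g x * (1 - x * c) powr s\<close> is the same
    for every \<open>x\<close>; this common value is \<open>a\<close> below.\<close>
  have lim: "(g \<longlongrightarrow> g x * (1 - x * c) powr s) (at 0)" if x: "x \<in> unit_disk" "x \<noteq> 0" for x
  proof -
    have "((\<lambda>y. g x * (1 - y * \<phi> x) powr (- s) * (1 - x * \<phi> y) powr s) \<longlongrightarrow>
        g x * (1 - 0 * \<phi> x) powr (- s) * (1 - x * c) powr s) (at 0)"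
      using nonpos(1)[OF x(1) c] by (intro tendsto_intros \<phi>_tendsto) auto
    moreover have "\<forall>\<^sub>F y in at 0. g x * (1 - y * \<phi> x) powr (- s) * (1 - x * \<phi> y) powr s = g y"
      unfolding eventually_at using g_eq[OF x(1)] x(2) by (intro exI[of _ 1]) auto
    ultimately show ?thesis
      by (auto intro: Lim_transform_eventually)
  qed
  obtain x0 where x0: "x0 \<in> unit_disk" "\<psi> x0 \<noteq> 0" using \<psi>_nz by blast
  then have "x0 \<noteq> 0" using \<open>\<psi> 0 = 0\<close> by auto
  define a where "a = g x0 * (1 - x0 * c) powr s"
  have "a \<noteq> 0"
    using x0 \<open>x0 \<noteq> 0\<close> nonpos(3)[OF x0(1) c] by (simp add: a_def g_def)
  have \<psi>_eq: "\<psi> x = a * x ^ n * (1 - c * x) powr (- s)" if x: "x \<in> unit_disk" for x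
  proof (cases "x = 0")
    case True
    then show ?thesis using \<open>\<psi> 0 = 0\<close> n by simp
  next
    case False
    have "g x * (1 - x * c) powr s = a"
      unfolding a_def using tendsto_unique[OF _ lim[OF x False] lim[OF x0(1) \<open>x0 \<noteq> 0\<close>]] by simp
    then have "g x = a * (1 - x * c) powr (- s)"
      using powr_cancel[OF nonpos(3)[OF x c]] by (auto simp: mult.assoc)
    then show ?thesis using False by (simp add: g_def field_simps)
  qed
  define b where "b = deriv \<phi> 0"
  have d\<phi>: "(\<phi> has_field_derivative b) (at 0)"
    unfolding b_def using \<phi>_holo by (rule holomorphic_derivI) auto
  have \<phi>_eq: "\<phi> x = c + b * x / (1 - c * x)" if x: "x \<in> unit_disk" for x
  proof (cases "x = 0")
    case True
    then show ?thesis by (simp add: c_def)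
  next
    case False
    let ?F = "\<lambda>y. (1 - c * x) powr (- s) * (1 - y * \<phi> x) powr (- s)"
    let ?G = "\<lambda>y. (1 - c * y) powr (- s) * (1 - x * \<phi> y) powr (- s)"
    have FG: "?F y = ?G y" if y: "y \<in> unit_disk" for y
    proof (cases "y = 0")
      case True
      then show ?thesis by (simp add: c_def mult.commute)
    next
      case False
      then show ?thesis
        using eq[OF x y] \<psi>_eq[OF x] \<psi>_eq[OF y] \<open>x \<noteq> 0\<close> \<open>a \<noteq> 0\<close> by (simp add: mult_ac)
    qed
    let ?u = "1 - c * x"
    have u: "?u \<notin> \<real>\<^sub>\<le>\<^sub>0" "?u \<noteq> 0" using nonpos[OF c x] by auto
    \<comment> \<open>The two derivatives at \<open>y = 0\<close> are compared, and
      \<open>s * ?u powr (- s)\<close> is divided out; this uses that \<open>s\<close> is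
      nonzero.\<close>
    have "(?F has_field_derivative (?u powr (- s) * (s * \<phi> x))) (at 0)"
      by (auto intro!: derivative_eq_intros)
    moreover have "(?F has_field_derivative (s * c * ?u powr (- s) + s * x * b * ?u powr (- s - 1))) (at 0)"
    proof (rule has_field_derivative_transform_within_open[where S = unit_disk])
      show "(?G has_field_derivative (s * c * ?u powr (- s) + s * x * b * ?u powr (- s - 1))) (at 0)"
        using u by (auto intro!: derivative_eq_intros d\<phi> simp: c_def[symmetric] mult_ac)
    qed (use FG in auto)
    ultimately have "?u powr (- s) * (s * \<phi> x) = s * c * ?u powr (- s) + s * x * b * ?u powr (- s - 1)"
      by (rule DERIV_unique)
    also have "?u powr (- s - 1) = ?u powr (- s) / ?u"
      using u(2) by (simp add: powr_diff)
    finally have "(?u powr (- s) * s) * \<phi> x = (?u powr (- s) * s) * (c + b * x / ?u)"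
      by (simp add: algebra_simps)
    then show ?thesis using u(2) s by simp
  qed
  have "b \<noteq> 0"
  proof
    assume "b = 0"
    then have "\<phi> constant_on unit_disk"
      using \<phi>_eq unfolding constant_on_def by auto
    with \<phi>_nonconst show False by contradiction
  qed
  then show ?thesis
    using \<open>a \<noteq> 0\<close> \<phi>_eq \<psi>_eq unfolding c_def by blast
qed

text \<open>Clearing the denominator gives \<open>(1 - c * x) * (1 - y * \<phi> x) = 1 - c * x - c *
  y + (c * c - b) * x * y\<close>, symmetric in \<open>x\<close> and \<open>y\<close>; positive real
  parts carry the symmetry over to the powers.\<close>

lemma functional_equation_holds:
  fixes \<phi> :: "complex \<Rightarrow> complex" and s :: complex
  assumes c: "c \<in> unit_disk" and x: "x \<in> unit_disk" and y: "y \<in> unit_disk"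
    and \<phi>_disk: "\<And>z. z \<in> unit_disk \<Longrightarrow> \<phi> z \<in> unit_disk"
    and \<phi>_eq: "\<And>z. z \<in> unit_disk \<Longrightarrow> \<phi> z = c + b * z / (1 - c * z)"
  shows "(1 - c * x) powr s * (1 - y * \<phi> x) powr s = (1 - c * y) powr s * (1 - x * \<phi> y) powr s"
proof (rule powr_eqI_of_mult_eq)
  have "(1 - c * z) * (1 - w * \<phi> z) = 1 - c * z - w * c + w * c * c * z - w * b * z"
    if "z \<in> unit_disk" for z w
    using one_minus_mult_notin_nonpos_Reals(3)[OF c that] unfolding \<phi>_eq[OF that]
    by (simp add: field_simps)
  from this[OF x, of y] this[OF y, of x]
  show "(1 - c * x) * (1 - y * \<phi> x) = (1 - c * y) * (1 - x * \<phi> y)"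
    by (simp only:) (simp add: mult_ac)
qed (intro one_minus_mult_notin_nonpos_Reals(2) c x y \<phi>_disk)+

section \<open>Undoing the change of variables\<close>

context bergman_conj
begin

lemma J_theta_disk: "cnj (\<theta> (cnj x)) \<in> unit_disk" if "x \<in> unit_disk"
  using theta_disk[of "cnj x"] that by simp

lemma theta_J_theta: "\<theta> (cnj (\<theta> (cnj x))) = x" if "x \<in> unit_disk"
  using theta_invol[of "cnj x"] that by simp

lemma J_theta_theta: "cnj (\<theta> (cnj (\<theta> x))) = x" if "x \<in> unit_disk"
  using theta_invol[OF that] by simp

lemma J_omega_omega: "cnj (\<omega> (cnj x)) * \<omega> (cnj (\<theta> (cnj x))) = 1" if "x \<in> unit_disk"
proof -
  have "cnj (\<omega> (cnj x) * cnj (\<omega> (cnj (\<theta> (cnj x))))) = cnj 1"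
    using omega_invol[of "cnj x"] that by simp
  then show ?thesis by simp
qed

lemma J_conj_in: "J_conj f \<in> H" and J_conj_norm: "nrm (J_conj f) = nrm f" if f: "f \<in> H"
proof -
  have tcJ: "tc (J_conj f) = (\<lambda>j. cnj (tc f j))"
    by (rule taylor_coeff_J_conj[OF bergmanD(1)[OF f]])
  show "J_conj f \<in> H"
    by (rule bergmanI) (use bergmanD[OF f] in \<open>auto simp: tcJ J_conj_holomorphic, auto simp: J_conj_def\<close>)
  show "nrm (J_conj f) = nrm f"
    by (simp add: bergman_norm_def tcJ)
qed

text \<open>\<open>Cj (K u)\<close> is a multiple of the kernel at \<open>cnj (\<theta> u)\<close>,
  so the inner product evaluates the image of \<open>K v\<close> there; the n-th derivative of
  \<open>K v\<close> supplies the Pochhammer factor and the raised exponent.\<close>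

lemma inner_comp_diff_op_kernels:
  assumes T: "bounded_operator \<alpha> (comp_diff_op \<psi> \<phi> n)"
    and \<phi>: "\<phi> ` unit_disk \<subseteq> unit_disk" and u: "u \<in> unit_disk" and v: "v \<in> unit_disk"
  shows "ip (comp_diff_op \<psi> \<phi> n (K v)) (Cj (K u)) =
    pochhammer (complex_of_real (\<alpha> + 2)) n * (cnj (\<omega> u) * \<psi> (cnj (\<theta> u)) * cnj v ^ n *
      (1 - cnj v * \<phi> (cnj (\<theta> u))) powr (- complex_of_real (real n + \<alpha> + 2)))"
proof -
  note TK = bounded_operatorD(1)[OF T kernel_in[OF v]]
  define x where "x = cnj (\<theta> u)"
  have x: "x \<in> unit_disk" unfolding x_def by (rule cnj_theta_disk[OF u])
  have \<phi>x: "\<phi> x \<in> unit_disk" using \<phi> x by blast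
  have "ip (comp_diff_op \<psi> \<phi> n (K v)) (Cj (K u)) = cnj (\<omega> u) * comp_diff_op \<psi> \<phi> n (K v) x"
    unfolding Cj_kernel[OF u] x_def[symmetric] inner_cmult_right[OF kernel_in[OF x] TK] reproducing[OF TK x] ..
  also have "comp_diff_op \<psi> \<phi> n (K v) x = \<psi> x * (deriv ^^ n) (K v) (\<phi> x)"
    using x by (simp add: comp_diff_op_def)
  also have "(deriv ^^ n) (K v) (\<phi> x) =
      (deriv ^^ n) (\<lambda>z. (1 - cnj v * z) powr (- complex_of_real (\<alpha> + 2))) (\<phi> x)"
    by (rule higher_deriv_cong_ev[OF eventually_mono[OF eventually_nhds_in_open[of unit_disk]]])
       (use \<phi>x in \<open>auto simp: bergman_kernel_def\<close>)
  also have "\<dots> = pochhammer (complex_of_real (\<alpha> + 2)) n * cnj v ^ n *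
      (1 - cnj v * \<phi> x) powr (- (complex_of_real (\<alpha> + 2) + of_nat n))"
    using v \<phi>x by (intro higher_deriv_one_minus_powr) auto
  also have "complex_of_real (\<alpha> + 2) + of_nat n = complex_of_real (real n + \<alpha> + 2)"
    by simp
  finally show ?thesis by (simp add: x_def mult_ac)
qed

text \<open>The kernel pairing is a nonzero constant times \<open>?E (cnj u) (cnj v)\<close>, and
  conjugation maps the disk onto itself, so \<open>u\<close> and \<open>v\<close> may be replaced by
  their conjugates.\<close>

lemma complex_symmetric_iff_functional_equation:
  assumes T: "bounded_operator \<alpha> (comp_diff_op \<psi> \<phi> n)" and \<phi>: "\<phi> ` unit_disk \<subseteq> unit_disk"
  shows "complex_symmetric \<alpha> Cj (comp_diff_op \<psi> \<phi> n) \<longleftrightarrow>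
    (\<forall>x\<in>unit_disk. \<forall>y\<in>unit_disk.
      cnj (\<omega> (cnj x)) * \<psi> (cnj (\<theta> (cnj x))) * y ^ n *
        (1 - y * \<phi> (cnj (\<theta> (cnj x)))) powr (- complex_of_real (real n + \<alpha> + 2))
      = cnj (\<omega> (cnj y)) * \<psi> (cnj (\<theta> (cnj y))) * x ^ n *
        (1 - x * \<phi> (cnj (\<theta> (cnj y)))) powr (- complex_of_real (real n + \<alpha> + 2)))"
    (is "_ \<longleftrightarrow> (\<forall>x\<in>unit_disk. \<forall>y\<in>unit_disk. ?E x y = ?E y x)")
proof -
  have pos: "pochhammer (complex_of_real (\<alpha> + 2)) n \<noteq> 0"
    using pochhammer_pos[of "\<alpha> + 2" n] alpha unfolding pochhammer_of_real by simp
  have "complex_symmetric \<alpha> Cj (comp_diff_op \<psi> \<phi> n) \<longleftrightarrow>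
      (\<forall>u\<in>unit_disk. \<forall>v\<in>unit_disk. ?E (cnj u) (cnj v) = ?E (cnj v) (cnj u))"
    unfolding complex_symmetric_iff_kernels[OF T]
    by (intro ball_cong refl) (simp only: inner_comp_diff_op_kernels[OF T \<phi>] mult_left_cancel[OF pos] complex_cnj_cnj)
  also have "\<dots> \<longleftrightarrow> (\<forall>x\<in>unit_disk. \<forall>y\<in>unit_disk. ?E x y = ?E y x)"
  proof
    assume L: "\<forall>u\<in>unit_disk. \<forall>v\<in>unit_disk. ?E (cnj u) (cnj v) = ?E (cnj v) (cnj u)"
    show "\<forall>x\<in>unit_disk. \<forall>y\<in>unit_disk. ?E x y = ?E y x"
    proof (intro ballI)
      fix x y :: complex assume "x \<in> unit_disk" "y \<in> unit_disk"
      then have "cnj x \<in> unit_disk" "cnj y \<in> unit_disk" by simp_all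
      with L have "?E (cnj (cnj x)) (cnj (cnj y)) = ?E (cnj (cnj y)) (cnj (cnj x))" by blast
      then show "?E x y = ?E y x" by (simp only: complex_cnj_cnj)
    qed
  next
    assume R: "\<forall>x\<in>unit_disk. \<forall>y\<in>unit_disk. ?E x y = ?E y x"
    show "\<forall>u\<in>unit_disk. \<forall>v\<in>unit_disk. ?E (cnj u) (cnj v) = ?E (cnj v) (cnj u)"
    proof (intro ballI)
      fix u v :: complex assume "u \<in> unit_disk" "v \<in> unit_disk"
      then have "cnj u \<in> unit_disk" "cnj v \<in> unit_disk" by simp_all
      with R show "?E (cnj u) (cnj v) = ?E (cnj v) (cnj u)" by blast
    qed
  qed
  finally show ?thesis .
qed

text \<open>The transported operator is \<open>J_conj\<close> after \<open>Cj\<close> after the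
  original one. Two conjugate-linear isometries compose to a linear isometry, so the same bound
  serves. This supplies the boundedness clause of \<open>admissible\<close>.\<close>

lemma bounded_operator_transfer:
  assumes T: "bounded_operator \<alpha> (comp_diff_op \<psi> \<phi> n)"
  shows "bounded_operator \<alpha> (comp_diff_op (\<lambda>x. cnj (\<omega> (cnj x)) * \<psi> (cnj (\<theta> (cnj x))))
    (\<lambda>x. \<phi> (cnj (\<theta> (cnj x)))) n)" (is "bounded_operator \<alpha> ?T'")
proof -
  let ?T = "comp_diff_op \<psi> \<phi> n"
  note TD = bounded_operatorD[OF T]
  have eq: "?T' f = J_conj (Cj (?T f))" for f
  proof
    show "?T' f x = J_conj (Cj (?T f)) x" for x
      using J_theta_disk[of x]
      by (cases "x \<in> unit_disk") (simp_all add: J_conj_def Cj_apply comp_diff_op_def del: comp_apply)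
  qed
  have in_H: "?T' f \<in> H" and norm: "nrm (?T' f) = nrm (?T f)" if "f \<in> H" for f
    unfolding eq using TD(1)[OF that] by (simp_all add: J_conj_in J_conj_norm Cj_in Cj_norm del: comp_apply)
  have J_add: "J_conj (\<lambda>z. f z + g z) = (\<lambda>z. J_conj f z + J_conj g z)"
    and J_cmult: "J_conj (\<lambda>z. k * f z) = (\<lambda>z. cnj k * J_conj f z)" for f g k
    by (simp_all add: J_conj_def)
  obtain M where M: "\<And>f. f \<in> H \<Longrightarrow> nrm (?T f) \<le> M * nrm f" using TD(4) by blast
  show ?thesis
    unfolding bounded_operator_def
  proof (intro conjI ballI allI exI[of _ M])
    show "?T' f \<in> H" if "f \<in> H" for f by (rule in_H[OF that])
    show "nrm (?T' f) \<le> M * nrm f" if "f \<in> H" for f using norm[OF that] M[OF that] by simp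
    show "?T' (\<lambda>z. f z + g z) = (\<lambda>z. ?T' f z + ?T' g z)" if "f \<in> H" "g \<in> H" for f g
      unfolding eq TD(2)[OF that] Cj_add J_add ..
    show "?T' (\<lambda>z. k * f z) = (\<lambda>z. k * ?T' f z)" if "f \<in> H" for k f
      unfolding eq TD(3)[OF that] Cj_cmult J_cmult by simp
  qed
qed

theorem complex_symmetric_iff_admissible:
  assumes n: "n > 0"
    and \<psi>_nz: "\<exists>z\<in>unit_disk. \<psi> z \<noteq> 0"
    and \<phi>_holo: "\<phi> holomorphic_on unit_disk"
    and \<phi>_disk: "\<phi> ` unit_disk \<subseteq> unit_disk"
    and \<phi>_nonconst: "\<not> \<phi> constant_on unit_disk"
    and T: "bounded_operator \<alpha> (comp_diff_op \<psi> \<phi> n)"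
  shows "complex_symmetric \<alpha> Cj (comp_diff_op \<psi> \<phi> n) \<longleftrightarrow>
    (\<exists>\<psi>' \<phi>'. admissible \<alpha> n \<psi>' \<phi>' \<and>
      (\<forall>z\<in>unit_disk. \<phi> z = \<phi>' (\<theta> z)) \<and> (\<forall>z\<in>unit_disk. \<psi> z = \<omega> z * \<psi>' (\<theta> z)))"
proof -
  let ?s = "complex_of_real (real n + \<alpha> + 2)"
  \<comment> \<open>\<open>\<tau>\<close> is the inverse of \<open>\<theta>\<close> on the disk, and
    \<open>cnj (\<omega> (cnj x))\<close> is the reciprocal of \<open>\<omega> (\<tau> x)\<close>.
    Hence \<open>\<psi>1\<close>, \<open>\<phi>1\<close> are the only candidates, as functions on
    the disk, for the admissible pair.\<close>
  define \<tau> where "\<tau> x = cnj (\<theta> (cnj x))" for x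
  define \<psi>1 where "\<psi>1 x = cnj (\<omega> (cnj x)) * \<psi> (\<tau> x)" for x
  define \<phi>1 where "\<phi>1 x = \<phi> (\<tau> x)" for x
  have \<tau>_disk: "\<tau> x \<in> unit_disk" if "x \<in> unit_disk" for x
    unfolding \<tau>_def by (rule J_theta_disk[OF that])
  have \<tau>_\<theta>: "\<tau> (\<theta> x) = x" and \<theta>_\<tau>: "\<theta> (\<tau> x) = x" if "x \<in> unit_disk" for x
    unfolding \<tau>_def using J_theta_theta[OF that] theta_J_theta[OF that] .
  have \<omega>_\<tau>: "cnj (\<omega> (cnj x)) * \<omega> (\<tau> x) = 1" if "x \<in> unit_disk" for x
    unfolding \<tau>_def by (rule J_omega_omega[OF that])
  have \<phi>_eq: "\<phi> z = \<phi>1 (\<theta> z)" and \<psi>_eq: "\<psi> z = \<omega> z * \<psi>1 (\<theta> z)" if z: "z \<in> unit_disk" for z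
  proof -
    show "\<phi> z = \<phi>1 (\<theta> z)" by (simp add: \<phi>1_def \<tau>_\<theta>[OF z])
    have "\<omega> z * \<psi>1 (\<theta> z) = (cnj (\<omega> (cnj (\<theta> z))) * \<omega> (\<tau> (\<theta> z))) * \<psi> z"
      by (simp add: \<psi>1_def \<tau>_\<theta>[OF z] mult_ac)
    then show "\<psi> z = \<omega> z * \<psi>1 (\<theta> z)" using \<omega>_\<tau>[OF theta_disk[OF z]] by simp
  qed
  have \<phi>1_disk: "\<phi>1 x \<in> unit_disk" if "x \<in> unit_disk" for x
    unfolding \<phi>1_def using \<phi>_disk \<tau>_disk[OF that] by blast
  then have \<phi>1_sub: "\<phi>1 ` unit_disk \<subseteq> unit_disk" by blast
  have cs_iff: "complex_symmetric \<alpha> Cj (comp_diff_op \<psi> \<phi> n) \<longleftrightarrow>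
      (\<forall>x\<in>unit_disk. \<forall>y\<in>unit_disk. \<psi>1 x * y ^ n * (1 - y * \<phi>1 x) powr (- ?s)
        = \<psi>1 y * x ^ n * (1 - x * \<phi>1 y) powr (- ?s))"
    using complex_symmetric_iff_functional_equation[OF T \<phi>_disk] by (simp only: \<psi>1_def \<phi>1_def \<tau>_def)
  show ?thesis
    unfolding cs_iff
  proof
    assume fe: "\<forall>x\<in>unit_disk. \<forall>y\<in>unit_disk. \<psi>1 x * y ^ n * (1 - y * \<phi>1 x) powr (- ?s)
        = \<psi>1 y * x ^ n * (1 - x * \<phi>1 y) powr (- ?s)"
    have "?s \<noteq> 0" using alpha by (simp only: of_real_eq_0_iff)
    have "\<tau> holomorphic_on unit_disk"
      using J_conj_holomorphic[OF theta_holo] by (simp add: J_conj_def[abs_def] \<tau>_def[abs_def])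
    then have "(\<phi> \<circ> \<tau>) holomorphic_on unit_disk"
      by (rule holomorphic_on_compose_gen[OF _ \<phi>_holo]) (use \<tau>_disk in auto)
    then have \<phi>1_holo: "\<phi>1 holomorphic_on unit_disk" by (simp add: comp_def \<phi>1_def[abs_def])
    have \<psi>1_nz: "\<exists>z\<in>unit_disk. \<psi>1 z \<noteq> 0"
      using \<psi>_nz \<psi>_eq theta_disk by (metis mult_zero_right)
    have \<phi>1_nonconst: "\<not> \<phi>1 constant_on unit_disk"
    proof
      assume "\<phi>1 constant_on unit_disk"
      then obtain k where "\<And>z. z \<in> unit_disk \<Longrightarrow> \<phi>1 z = k" unfolding constant_on_def by blast
      then have "\<phi> constant_on unit_disk"
        using \<phi>_eq theta_disk unfolding constant_on_def by metis
      with \<phi>_nonconst show False by contradiction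
    qed
    obtain a b where "a \<noteq> 0 \<and> b \<noteq> 0 \<and>
      (\<forall>z\<in>unit_disk. \<phi>1 z = \<phi>1 0 + b * z / (1 - \<phi>1 0 * z)) \<and>
      (\<forall>z\<in>unit_disk. \<psi>1 z = a * z ^ n * (1 - \<phi>1 0 * z) powr (- ?s))"
      using functional_equation_solution[OF n \<open>?s \<noteq> 0\<close> \<phi>1_holo \<phi>1_sub \<psi>1_nz \<phi>1_nonconst fe]
      by (elim exE)
    note ab = this[THEN conjunct1] this[THEN conjunct2, THEN conjunct1]
      this[THEN conjunct2, THEN conjunct2, THEN conjunct1, rule_format]
      this[THEN conjunct2, THEN conjunct2, THEN conjunct2, rule_format]
    \<comment> \<open>The factor \<open>fact n\<close> in the witness compensates the normalization
      by \<open>fact n\<close> in \<open>admissible\<close>.\<close>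
    have "admissible \<alpha> n \<psi>1 \<phi>1"
      unfolding admissible_def
    proof (intro conjI, rule exI[of _ "a * fact n"], rule exI[of _ b], rule exI[of _ "\<phi>1 0"],
        intro conjI ballI)
      show "a * fact n \<noteq> 0" "b \<noteq> 0" using ab(1,2) by auto
      show "\<phi>1 0 \<in> unit_disk" by (rule \<phi>1_disk) simp
      show "\<phi>1 ` unit_disk \<subseteq> unit_disk" by (rule \<phi>1_sub)
      show "bounded_operator \<alpha> (comp_diff_op \<psi>1 \<phi>1 n)"
        using bounded_operator_transfer[OF T] by (simp only: \<psi>1_def[abs_def] \<phi>1_def[abs_def] \<tau>_def)
      fix z :: complex assume z: "z \<in> unit_disk"
      show "\<phi>1 z = \<phi>1 0 + b * z / (1 - \<phi>1 0 * z)" by (rule ab(3)[OF z])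
      show "\<psi>1 z = a * fact n * z ^ n / (fact n * (1 - \<phi>1 0 * z) powr ?s)"
        unfolding ab(4)[OF z] powr_minus by (simp add: divide_inverse)
    qed
    then show "\<exists>\<psi>' \<phi>'. admissible \<alpha> n \<psi>' \<phi>' \<and>
      (\<forall>z\<in>unit_disk. \<phi> z = \<phi>' (\<theta> z)) \<and> (\<forall>z\<in>unit_disk. \<psi> z = \<omega> z * \<psi>' (\<theta> z))"
      using \<phi>_eq \<psi>_eq by blast
  next
    assume "\<exists>\<psi>' \<phi>'. admissible \<alpha> n \<psi>' \<phi>' \<and>
      (\<forall>z\<in>unit_disk. \<phi> z = \<phi>' (\<theta> z)) \<and> (\<forall>z\<in>unit_disk. \<psi> z = \<omega> z * \<psi>' (\<theta> z))"
    then obtain \<psi>' \<phi>' where adm: "admissible \<alpha> n \<psi>' \<phi>'"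
      and \<phi>': "\<And>z. z \<in> unit_disk \<Longrightarrow> \<phi> z = \<phi>' (\<theta> z)"
      and \<psi>': "\<And>z. z \<in> unit_disk \<Longrightarrow> \<psi> z = \<omega> z * \<psi>' (\<theta> z)" by blast
    obtain a b c where c: "c \<in> unit_disk"
      and \<phi>'_eq: "\<And>z. z \<in> unit_disk \<Longrightarrow> \<phi>' z = c + b * z / (1 - c * z)"
      and \<psi>'_eq: "\<And>z. z \<in> unit_disk \<Longrightarrow> \<psi>' z = a * z ^ n / (fact n * (1 - c * z) powr ?s)"
      using adm unfolding admissible_def by blast
    \<comment> \<open>The given pair is known only along \<open>\<theta>\<close>; substituting
      \<open>\<tau> x\<close> shows that it coincides with \<open>\<psi>1\<close>,
      \<open>\<phi>1\<close> on the disk.\<close>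
    have \<phi>1_eq: "\<phi>1 x = c + b * x / (1 - c * x)" if x: "x \<in> unit_disk" for x
      using \<phi>'[OF \<tau>_disk[OF x]] \<theta>_\<tau>[OF x] \<phi>'_eq[OF x] by (simp add: \<phi>1_def)
    have \<psi>1_eq: "\<psi>1 x = (a / fact n) * x ^ n * (1 - c * x) powr (- ?s)" if x: "x \<in> unit_disk" for x
    proof -
      have "\<psi>1 x = (cnj (\<omega> (cnj x)) * \<omega> (\<tau> x)) * \<psi>' x"
        using \<psi>'[OF \<tau>_disk[OF x]] \<theta>_\<tau>[OF x] by (simp add: \<psi>1_def mult_ac)
      then have "\<psi>1 x = \<psi>' x" by (simp add: \<omega>_\<tau>[OF x])
      then show ?thesis unfolding \<psi>'_eq[OF x] powr_minus by (simp add: divide_inverse)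
    qed
    show "\<forall>x\<in>unit_disk. \<forall>y\<in>unit_disk. \<psi>1 x * y ^ n * (1 - y * \<phi>1 x) powr (- ?s)
        = \<psi>1 y * x ^ n * (1 - x * \<phi>1 y) powr (- ?s)"
    proof (intro ballI)
      fix x y :: complex assume x: "x \<in> unit_disk" and y: "y \<in> unit_disk"
      let ?p = "(a / fact n) * x ^ n * y ^ n"
      have "\<psi>1 x * y ^ n * (1 - y * \<phi>1 x) powr (- ?s)
          = ?p * ((1 - c * x) powr (- ?s) * (1 - y * \<phi>1 x) powr (- ?s))"
        unfolding \<psi>1_eq[OF x] by (simp only: mult_ac)
      also have "\<dots> = ?p * ((1 - c * y) powr (- ?s) * (1 - x * \<phi>1 y) powr (- ?s))"
        by (simp only: functional_equation_holds[OF c x y \<phi>1_disk \<phi>1_eq])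
      also have "\<dots> = \<psi>1 y * x ^ n * (1 - x * \<phi>1 y) powr (- ?s)"
        unfolding \<psi>1_eq[OF y] by (simp only: mult_ac)
      finally show "\<psi>1 x * y ^ n * (1 - y * \<phi>1 x) powr (- ?s) = \<psi>1 y * x ^ n * (1 - x * \<phi>1 y) powr (- ?s)" .
    qed
  qed
qed

end

section \<open>The two families of conjugations\<close>

lemma bergman_conj_rotation:
  assumes "\<alpha> > -1" "cmod \<mu> = 1" "cmod l = 1"
  shows "bergman_conj \<alpha> (\<lambda>_. \<mu>) (\<lambda>z. l * z)"
proof
  have unimodular: "u * cnj u = 1" if "cmod u = 1" for u
    using complex_norm_square[of u] that by simp
  show "l * cnj (l * z) = cnj z" for z
    using unimodular[OF assms(3)] by (simp flip: mult.assoc)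
  show "\<mu> * cnj \<mu> = 1" by (rule unimodular[OF assms(2)])
qed (use assms in \<open>auto intro!: holomorphic_intros simp: norm_mult mult_ac\<close>)

text \<open>The factor \<open>cnj p / p\<close> in \<open>phi_p\<close> makes
  \<open>(1 - cnj p * z) * (1 - w * phi_p p z)\<close> symmetric in \<open>z\<close> and
  \<open>w\<close>, which yields the kernel symmetry. Its value \<open>1 - (cmod p)\<^sup>2\<close>
  at \<open>w = p\<close> drives both involution identities.\<close>

lemma bergman_conj_phi_p:
  assumes \<alpha>: "\<alpha> > -1" and p: "p \<in> unit_disk - {0}" and \<eta>: "cmod \<eta> = 1"
  shows "bergman_conj \<alpha> (psi_p \<alpha> \<eta> p) (phi_p p)"
proof
  define k where "k = \<eta> * complex_of_real ((1 - (cmod p)\<^sup>2) powr ((\<alpha> + 2) / 2))"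
  let ?s = "complex_of_real (\<alpha> + 2)"
  have p_nz: "p \<noteq> 0" and cp: "cnj p \<in> unit_disk" and p1: "cmod p < 1" using p by auto
  have psi: "psi_p \<alpha> \<eta> p z = k * (1 - cnj p * z) powr (- ?s)" for z
    unfolding psi_p_def k_def powr_minus by (simp only: divide_inverse)
  note nz = one_minus_mult_notin_nonpos_Reals(3)[OF cp]
  show "\<alpha> > -1" by (rule \<alpha>)
  show "psi_p \<alpha> \<eta> p holomorphic_on unit_disk"
    unfolding psi[abs_def] by (intro holomorphic_intros one_minus_powr_holomorphic cp)
  show "phi_p p holomorphic_on unit_disk"
    unfolding phi_p_def[abs_def] using nz by (intro holomorphic_intros) (auto simp: p_nz)
  show phi_disk: "phi_p p z \<in> unit_disk" if z: "z \<in> unit_disk" for z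
  proof -
    \<comment> \<open>\<open>phi_p\<close> differs from the Moebius function only by a sign and the
      unimodular factor \<open>cnj p / p\<close>.\<close>
    have "cmod (phi_p p z) = cmod (Moebius_function 0 p z)"
      using p_nz by (simp add: phi_p_def Moebius_function_simple norm_mult norm_divide norm_minus_commute)
    then show ?thesis
      using Moebius_function_norm_lt_1[of p z 0] z p1 by simp
  qed
  have mult_phi: "(1 - cnj p * z) * (1 - w * phi_p p z) = 1 - cnj p * z - cnj p * w + cnj p / p * z * w"
    if "z \<in> unit_disk" for z w
    using nz[OF that] p_nz by (simp add: phi_p_def field_simps)
  show "psi_p \<alpha> \<eta> p z * (1 - w * phi_p p z) powr (- ?s) = psi_p \<alpha> \<eta> p w * (1 - z * phi_p p w) powr (- ?s)"
    if z: "z \<in> unit_disk" and w: "w \<in> unit_disk" for z w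
  proof -
    have "(1 - cnj p * z) powr (- ?s) * (1 - w * phi_p p z) powr (- ?s)
        = (1 - cnj p * w) powr (- ?s) * (1 - z * phi_p p w) powr (- ?s)"
    proof (rule powr_eqI_of_mult_eq)
      show "(1 - cnj p * z) * (1 - w * phi_p p z) = (1 - cnj p * w) * (1 - z * phi_p p w)"
        unfolding mult_phi[OF z] mult_phi[OF w] by (simp add: mult_ac)
    qed (intro one_minus_mult_notin_nonpos_Reals(2) cp z w phi_disk)+
    then show ?thesis unfolding psi by (simp add: mult.assoc)
  qed
  have pp: "p * cnj p = complex_of_real ((cmod p)\<^sup>2)" by (simp only: complex_norm_square)
  have q_pos: "1 - (cmod p)\<^sup>2 > 0" using p1 by (simp add: power_less_one_iff)
  have one_minus: "(1 - cnj p * z) * (1 - p * phi_p p z) = complex_of_real (1 - (cmod p)\<^sup>2)"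
    if z: "z \<in> unit_disk" for z
    using mult_phi[OF z, of p] p_nz pp by (simp add: mult_ac)
  have cnj_one_minus: "1 - cnj p * cnj (phi_p p z) = complex_of_real (1 - (cmod p)\<^sup>2) / (1 - p * cnj z)"
    if z: "z \<in> unit_disk" for z
    using arg_cong[OF one_minus[OF z], of cnj] nz[OF z]
      one_minus_mult_notin_nonpos_Reals(3)[of p "cnj z"] z p1
    by (simp add: field_simps)
  show "phi_p p (cnj (phi_p p z)) = cnj z" if z: "z \<in> unit_disk" for z
  proof -
    have nz': "1 - p * cnj z \<noteq> 0"
      using one_minus_mult_notin_nonpos_Reals(3)[of p "cnj z"] z p1 by simp
    \<comment> \<open>Numerator of \<open>phi_p\<close> at \<open>cnj (phi_p p z)\<close>; it shares
      with the denominator \<open>cnj_one_minus\<close> a factor that cancels in the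
      quotient.\<close>
    have "p - cnj (phi_p p z) = p / cnj p * cnj z * complex_of_real (1 - (cmod p)\<^sup>2) / (1 - p * cnj z)"
      using nz' p_nz pp by (simp add: phi_p_def field_simps power2_eq_square)
    then have "phi_p p (cnj (phi_p p z)) = cnj p / p * ((p / cnj p * cnj z * complex_of_real (1 - (cmod p)\<^sup>2)
        / (1 - p * cnj z)) / (complex_of_real (1 - (cmod p)\<^sup>2) / (1 - p * cnj z)))"
      by (simp only: phi_p_def[of p "cnj (phi_p p z)"] cnj_one_minus[OF z])
    moreover have "complex_of_real (1 - (cmod p)\<^sup>2) \<noteq> 0"
      using q_pos by (simp only: of_real_eq_0_iff)
    ultimately show ?thesis
      using nz' p_nz by (simp del: of_real_diff)
  qed
  show "psi_p \<alpha> \<eta> p z * cnj (psi_p \<alpha> \<eta> p (cnj (phi_p p z))) = 1" if z: "z \<in> unit_disk" for z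
  proof -
    let ?q = "1 - (cmod p)\<^sup>2" and ?w = "phi_p p z"
    have re: "Re (1 - cnj p * z) > 0" "Re (1 - p * ?w) > 0" "Re (1 - cnj p * cnj ?w) > 0"
      by (intro one_minus_mult_notin_nonpos_Reals(2) cp z phi_disk; use p1 phi_disk[OF z] in simp)+
    have cnj_psi: "cnj (psi_p \<alpha> \<eta> p (cnj ?w)) = cnj k * (1 - p * ?w) powr (- ?s)"
      unfolding psi using re(3) by (simp add: cnj_powr less_imp_le)
    have "psi_p \<alpha> \<eta> p z * cnj (psi_p \<alpha> \<eta> p (cnj ?w))
        = (k * cnj k) * ((1 - cnj p * z) powr (- ?s) * (1 - p * ?w) powr (- ?s))"
      unfolding cnj_psi psi[of z] by (simp only: mult_ac)
    \<comment> \<open>The factor \<open>1 powr (- ?s)\<close> pads the right side to the two-factor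
      form of \<open>powr_eqI_of_mult_eq\<close>. The resulting power of \<open>?q\<close> is
      cancelled by \<open>k * cnj k\<close>, which explains the exponent
      \<open>(\<alpha> + 2) / 2\<close> in \<open>psi_p\<close>.\<close>
    also have "(1 - cnj p * z) powr (- ?s) * (1 - p * ?w) powr (- ?s)
        = complex_of_real ?q powr (- ?s) * 1 powr (- ?s)"
      by (rule powr_eqI_of_mult_eq) (use re one_minus[OF z] q_pos in auto)
    also have "complex_of_real ?q powr (- ?s) = complex_of_real (?q powr (- (\<alpha> + 2)))"
      using q_pos powr_of_real[of ?q "- (\<alpha> + 2)"] by (simp add: less_imp_le)
    also have "k * cnj k = complex_of_real ((cmod k)\<^sup>2)"
      by (simp only: complex_norm_square)
    also have "cmod k = ?q powr ((\<alpha> + 2) / 2)"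
      by (simp add: k_def norm_mult \<eta>)
    also have "(?q powr ((\<alpha> + 2) / 2))\<^sup>2 = ?q powr (\<alpha> + 2)"
      using q_pos by (simp add: power2_eq_square flip: powr_add)
    finally have "psi_p \<alpha> \<eta> p z * cnj (psi_p \<alpha> \<eta> p (cnj ?w))
        = complex_of_real (?q powr (\<alpha> + 2) * ?q powr (- (\<alpha> + 2)))"
      by simp
    also have "?q powr (\<alpha> + 2) * ?q powr (- (\<alpha> + 2)) = 1"
      using q_pos by (simp add: powr_add[symmetric])
    finally show ?thesis by simp
  qed
qed

theorem theorem2p8:
  fixes \<alpha> :: real and n :: nat and \<psi> \<phi> :: "complex \<Rightarrow> complex"
  assumes "\<alpha> > -1"
    and "n > 0"
    and "\<psi> holomorphic_on unit_disk"
    and "\<exists>z\<in>unit_disk. \<psi> z \<noteq> 0"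
    and "\<phi> holomorphic_on unit_disk"
    and "\<phi> ` unit_disk \<subseteq> unit_disk"
    and "\<not> \<phi> constant_on unit_disk"
    and "bounded_operator \<alpha> (comp_diff_op \<psi> \<phi> n)"
  shows "(\<forall>p \<eta>. p \<in> unit_disk - {0} \<longrightarrow> cmod \<eta> = 1 \<longrightarrow>
            (complex_symmetric \<alpha> (weighted_comp_op (psi_p \<alpha> \<eta> p) (phi_p p) \<circ> J_conj)
                (comp_diff_op \<psi> \<phi> n) \<longleftrightarrow>
             (\<exists>\<psi>' \<phi>'. admissible \<alpha> n \<psi>' \<phi>' \<and>
                (\<forall>z\<in>unit_disk. \<phi> z = \<phi>' (phi_p p z)) \<and>
                (\<forall>z\<in>unit_disk. \<psi> z = psi_p \<alpha> \<eta> p z * \<psi>' (phi_p p z))))) \<and>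
         (\<forall>\<mu> lam. cmod \<mu> = 1 \<longrightarrow> cmod lam = 1 \<longrightarrow>
            (complex_symmetric \<alpha> (weighted_comp_op (\<lambda>_. \<mu>) (\<lambda>z. lam * z) \<circ> J_conj)
                (comp_diff_op \<psi> \<phi> n) \<longleftrightarrow>
             (\<exists>\<psi>' \<phi>'. admissible \<alpha> n \<psi>' \<phi>' \<and>
                (\<forall>z\<in>unit_disk. \<psi> z = \<mu> * \<psi>' (lam * z)) \<and>
                (\<forall>z\<in>unit_disk. \<phi> z = \<phi>' (lam * z)))))"
proof (intro conjI allI impI)
  fix p \<eta> assume "p \<in> unit_disk - {0}" "cmod \<eta> = 1"
  then interpret bergman_conj \<alpha> "psi_p \<alpha> \<eta> p" "phi_p p"
    by (rule bergman_conj_phi_p[OF assms(1)])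
  show "complex_symmetric \<alpha> Cj (comp_diff_op \<psi> \<phi> n) \<longleftrightarrow>
      (\<exists>\<psi>' \<phi>'. admissible \<alpha> n \<psi>' \<phi>' \<and> (\<forall>z\<in>unit_disk. \<phi> z = \<phi>' (phi_p p z)) \<and>
        (\<forall>z\<in>unit_disk. \<psi> z = psi_p \<alpha> \<eta> p z * \<psi>' (phi_p p z)))"
    by (rule complex_symmetric_iff_admissible[OF assms(2,4-8)])
next
  fix \<mu> lam :: complex assume "cmod \<mu> = 1" "cmod lam = 1"
  then interpret bergman_conj \<alpha> "\<lambda>_. \<mu>" "\<lambda>z. lam * z"
    by (rule bergman_conj_rotation[OF assms(1)])
  show "complex_symmetric \<alpha> Cj (comp_diff_op \<psi> \<phi> n) \<longleftrightarrow>
      (\<exists>\<psi>' \<phi>'. admissible \<alpha> n \<psi>' \<phi>' \<and> (\<forall>z\<in>unit_disk. \<psi> z = \<mu> * \<psi>' (lam * z)) \<and>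
        (\<forall>z\<in>unit_disk. \<phi> z = \<phi>' (lam * z)))"
    using complex_symmetric_iff_admissible[OF assms(2,4-8)] by blast
qed

end
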